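(* The group $\mathcal A(\mathbb Z)$ has the following properties: (1) the additive group $\mathbb Q$ of rational numbers embeds as a subgroup of $\mathcal A(\mathbb Z)$; (2) $\mathcal A(\mathbb Z)$ has no infinite cyclic quotient (i.e. it is not indicable); (3) $\mathcal A(\mathbb Z)$ is locally free (every finitely generated subgroup is free).
   Context: For a sequence of groups $(G_n)_{n\in\mathbb N}$, an infinite word is a map $w:L\to\bigsqcup_n (G_n\setminus\{1\})$ (disjoint union) from a countable linearly ordered set $L$ such that $w^{-1}(G_n)$ is finite for every $n$. For each $m$, the projection $p_m(w)\in G_1*\cdots*G_m$ is the element represented by the finite word obtained by restricting $w$ to the letters lying in $G_1\cup\dots\cup G_m$. Two infinite words are equivalent if all their projections agree. The topologist's product $\circledast_n G_n$ is the group of equivalence classes, with multiplication induced by concatenation and inversion by reversing the order and inverting each letter. The free product $*_n G_n$ is the subgroup of classes of finite words. The archipelago group is $\mathcal A(G_n):=\circledast_n G_n/\langle\langle *_n G_n\rangle\rangle$ (quotient by the normal closure). $\mathcal A(\mathbb Z)$ denotes the archipelago group of the constant sequence $G_n=\mathbb Z$ for all $n$ (it is the fundamental group of the harmonic archipelago). *)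

theory Defs
  imports "HOL-Algebra.Algebra"
begin

text \<open>Letters are pairs (n, g) with g a non-identity element of G n (disjoint union).
  The countable linearly ordered index set L of a word is realised as a subset of the
  rationals (every countable linear order embeds in Q); a word is a partial map
  rat -> letter whose domain is L.\<close>

type_synonym 'g word = "rat \<Rightarrow> (nat \<times> 'g) option"

definition is_word :: "(nat \<Rightarrow> 'g monoid) \<Rightarrow> 'g word \<Rightarrow> bool" where
  "is_word G w \<longleftrightarrow>
     (\<forall>q n g. w q = Some (n, g) \<longrightarrow> g \<in> carrier (G n) \<and> g \<noteq> \<one>\<^bsub>G n\<^esub>) \<and>
     (\<forall>n. finite {q. \<exists>g. w q = Some (n, g)})"

definition words :: "(nat \<Rightarrow> 'g monoid) \<Rightarrow> 'g word set" where
  "words G = {w. is_word G w}"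

text \<open>Normal form in the free product G_0 * ... * G_m: reduced words (lists of letters,
  no identity letters, adjacent letters from different factors).\<close>

definition push_letter :: "(nat \<Rightarrow> 'g monoid) \<Rightarrow> nat \<times> 'g \<Rightarrow> (nat \<times> 'g) list \<Rightarrow> (nat \<times> 'g) list" where
  "push_letter G a xs = (case xs of
      [] \<Rightarrow> [a]
    | b # rest \<Rightarrow>
        (if fst b = fst a then
           (if snd a \<otimes>\<^bsub>G (fst a)\<^esub> snd b = \<one>\<^bsub>G (fst a)\<^esub> then rest
            else (fst a, snd a \<otimes>\<^bsub>G (fst a)\<^esub> snd b) # rest)
         else a # xs))"

definition reduce :: "(nat \<Rightarrow> 'g monoid) \<Rightarrow> (nat \<times> 'g) list \<Rightarrow> (nat \<times> 'g) list" where
  "reduce G xs = foldr (push_letter G) xs []"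

definition proj :: "(nat \<Rightarrow> 'g monoid) \<Rightarrow> nat \<Rightarrow> 'g word \<Rightarrow> (nat \<times> 'g) list" where
  "proj G m w = reduce G
     (map (\<lambda>q. the (w q)) (sorted_list_of_set {q. \<exists>n g. w q = Some (n, g) \<and> n \<le> m}))"

definition word_equiv :: "(nat \<Rightarrow> 'g monoid) \<Rightarrow> 'g word \<Rightarrow> 'g word \<Rightarrow> bool" where
  "word_equiv G u v \<longleftrightarrow> (\<forall>m. proj G m u = proj G m v)"

definition wclass :: "(nat \<Rightarrow> 'g monoid) \<Rightarrow> 'g word \<Rightarrow> 'g word set" where
  "wclass G w = {v \<in> words G. word_equiv G w v}"

text \<open>Concatenation: order-embed Q into (-2,0) and (0,2) via x \<mapsto> x/(1+|x|) \<plusminus> 1.\<close>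

definition squash :: "rat \<Rightarrow> rat" where "squash x = x / (1 + \<bar>x\<bar>)"
definition unsquash :: "rat \<Rightarrow> rat" where "unsquash y = y / (1 - \<bar>y\<bar>)"

definition concat_word :: "'g word \<Rightarrow> 'g word \<Rightarrow> 'g word" where
  "concat_word u v = (\<lambda>q. if -2 < q \<and> q < 0 then u (unsquash (q + 1))
                         else if 0 < q \<and> q < 2 then v (unsquash (q - 1))
                         else None)"

definition inv_word :: "(nat \<Rightarrow> 'g monoid) \<Rightarrow> 'g word \<Rightarrow> 'g word" where
  "inv_word G w = (\<lambda>q. map_option (\<lambda>(n, g). (n, inv\<^bsub>G n\<^esub> g)) (w (- q)))"

definition class_mult :: "(nat \<Rightarrow> 'g monoid) \<Rightarrow> 'g word set \<Rightarrow> 'g word set \<Rightarrow> 'g word set" where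
  "class_mult G A B = wclass G (concat_word (SOME a. a \<in> A) (SOME b. b \<in> B))"

definition top_product :: "(nat \<Rightarrow> 'g monoid) \<Rightarrow> 'g word set monoid" where
  "top_product G = \<lparr> carrier = wclass G ` words G,
      monoid.mult = class_mult G,
      one = wclass G (\<lambda>_. None) \<rparr>"

definition free_prod_sub :: "(nat \<Rightarrow> 'g monoid) \<Rightarrow> 'g word set set" where
  "free_prod_sub G = {C \<in> carrier (top_product G). \<exists>w \<in> C. finite (dom w)}"

definition normal_closure :: "('a, 'b) monoid_scheme \<Rightarrow> 'a set \<Rightarrow> 'a set" where
  "normal_closure H S = \<Inter> {N. N \<lhd> H \<and> S \<subseteq> N}"

definition archipelago :: "(nat \<Rightarrow> 'g monoid) \<Rightarrow> 'g word set set monoid" where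
  "archipelago G = top_product G Mod normal_closure (top_product G) (free_prod_sub G)"

definition archipelago_Z :: "int word set set monoid" where
  "archipelago_Z = archipelago (\<lambda>n. integer_group)"

definition rat_group :: "rat monoid" where
  "rat_group = \<lparr> carrier = UNIV, monoid.mult = (+), one = 0 \<rparr>"

definition freely_reduced :: "('a \<times> bool) list \<Rightarrow> bool" where
  "freely_reduced ws \<longleftrightarrow>
     (\<forall>i. Suc i < length ws \<longrightarrow> \<not> (fst (ws ! i) = fst (ws ! Suc i) \<and> snd (ws ! i) \<noteq> snd (ws ! Suc i)))"

definition eval_gword :: "('a, 'b) monoid_scheme \<Rightarrow> ('a \<times> bool) list \<Rightarrow> 'a" where
  "eval_gword H ws = foldr (\<lambda>(x, b) acc. (if b then x else inv\<^bsub>H\<^esub> x) \<otimes>\<^bsub>H\<^esub> acc) ws \<one>\<^bsub>H\<^esub>"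

definition free_basis :: "('a, 'b) monoid_scheme \<Rightarrow> 'a set \<Rightarrow> bool" where
  "free_basis H B \<longleftrightarrow> B \<subseteq> carrier H \<and> generate H B = carrier H \<and>
     (\<forall>ws. ws \<noteq> [] \<and> set (map fst ws) \<subseteq> B \<and> freely_reduced ws \<longrightarrow> eval_gword H ws \<noteq> \<one>\<^bsub>H\<^esub>)"

definition free_group :: "('a, 'b) monoid_scheme \<Rightarrow> bool" where
  "free_group H \<longleftrightarrow> group H \<and> (\<exists>B. free_basis H B)"

end

theory Submission
  imports Defs
begin

text \<open>The archipelago group is the quotient of the topologist's product \<open>H\<close> by the increasing union
  over \<open>n\<close> of the kernels of the maps forgetting the letters of index below \<open>n\<close>, and each of
  these kernels is the decreasing intersection over \<open>m\<close> of the kernels of the projections of \<open>H\<close> to the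
  free group on the letters of index \<open>n, \<dots>, m\<close>.

  Local freeness is therefore a matter of passing to limits. A free group has Nielsen's property: a finite
  subset either is free or generates a subgroup that needs fewer generators. Since the least number of
  generators of the images of a fixed finitely generated subgroup is monotone and bounded along either
  limit, it is eventually constant, and then the property (in its Hopfian form) makes the transition
  maps injective on that subgroup; hence the property survives in the limit, where it gives
  local freeness and absence of torsion.

  For the other two claims, given words \<open>x n\<close> in letters of index at least \<open>n\<close> and exponents \<open>k n\<close>, there are
  infinite words with \<open>y n = x n (y (n+1))\<^sup>k\<^sup>n\<close>. If the \<open>x n\<close> are single letters, they die in the
  quotient and \<open>k n = n + 2\<close> yields a copy of the rationals. If a homomorphism \<open>f\<close> to the integers
  takes the value 1, it does so on some \<open>x n\<close> for every \<open>n\<close>, and \<open>k n = 3\<close> makes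
  \<open>2 f (y 0) + 1\<close> divisible by all powers of 3.\<close>

section \<open>Free products of infinite cyclic groups\<close>

text \<open>The invariant compared between stages is a number, the rank of the image of a fixed
  finite set. A generating set of minimal size at a finer stage still generates at a coarser one; if
  the rank has not dropped, it is minimal there too, hence free there by Nielsen's property. A
  relation holding at the coarser stage is then the empty word already at the finer one, which is
  why equal ranks force injectivity. For free groups, Nielsen's property is not proved by
  cancellation in products of generators. Schreier's construction supplies some basis of a finitely
  generated subgroup, and finite permutation groups compare its size with that of the given
  generating set. The infinite words in the last two claims must contain each index only finitely
  often. This is why the word inserted at level \<open>n\<close> has to use indices at least
  \<open>n\<close>, and why a homomorphism to the integers is tested on the tails of one word:
  modulo the kernel, erasing finitely many letters changes nothing.\<close>

abbreviation ZZ :: "nat \<Rightarrow> int monoid" where "ZZ \<equiv> \<lambda>_. integer_group"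

definition nonzero_letters :: "(nat \<times> int) list \<Rightarrow> bool" where
  "nonzero_letters xs \<longleftrightarrow> (\<forall>a\<in>set xs. snd a \<noteq> 0)"

definition reduced :: "(nat \<times> int) list \<Rightarrow> bool" where
  "reduced xs \<longleftrightarrow> nonzero_letters xs \<and> successively (\<lambda>a b. fst a \<noteq> fst b) xs"

definition FZ :: "(nat \<times> int) list monoid" where
  "FZ = \<lparr>carrier = {xs. reduced xs}, monoid.mult = (\<lambda>xs ys. reduce ZZ (xs @ ys)), one = []\<rparr>"

lemma push_letter_simps [simp]:
  "push_letter ZZ a [] = [a]"
  "push_letter ZZ a (b # xs) =
     (if fst b = fst a then if snd a + snd b = 0 then xs else (fst a, snd a + snd b) # xs
      else a # b # xs)"
  by (auto simp: push_letter_def)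

lemma nonzero_letters_simps [simp]:
  "nonzero_letters []"
  "nonzero_letters (a # xs) \<longleftrightarrow> snd a \<noteq> 0 \<and> nonzero_letters xs"
  "nonzero_letters (xs @ ys) \<longleftrightarrow> nonzero_letters xs \<and> nonzero_letters ys"
  by (auto simp: nonzero_letters_def)

lemma reduce_simps [simp]:
  "reduce G [] = []"
  "reduce G (a # xs) = push_letter G a (reduce G xs)"
  by (auto simp: reduce_def)

lemma reduce_append: "reduce G (xs @ ys) = foldr (push_letter G) xs (reduce G ys)"
  by (simp add: reduce_def)

lemma reduced_Nil [simp]: "reduced []"
  by (simp add: reduced_def)

lemma reduced_Cons:
  "reduced (a # xs) \<longleftrightarrow> snd a \<noteq> 0 \<and> reduced xs \<and> (xs = [] \<or> fst (hd xs) \<noteq> fst a)"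
  by (cases xs) (auto simp: reduced_def)

lemma reduced_nonzero_letters: "reduced xs \<Longrightarrow> nonzero_letters xs"
  by (simp add: reduced_def)

lemma reduced_push_letter:
  "reduced xs \<Longrightarrow> snd a \<noteq> 0 \<Longrightarrow> reduced (push_letter ZZ a xs)"
  by (cases xs) (auto simp: reduced_Cons)

lemma reduced_foldr_push:
  "reduced r \<Longrightarrow> nonzero_letters xs \<Longrightarrow> reduced (foldr (push_letter ZZ) xs r)"
  by (induction xs) (auto simp: reduced_push_letter)

lemma reduced_reduce: "nonzero_letters xs \<Longrightarrow> reduced (reduce ZZ xs)"
  by (simp add: reduce_def reduced_foldr_push)

lemma reduce_reduced: "reduced xs \<Longrightarrow> reduce ZZ xs = xs"
proof (induction xs)
  case (Cons a xs)
  then show ?case by (cases xs) (auto simp: reduced_Cons)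
qed simp

lemma push_push_same:
  assumes "reduced r" "a \<noteq> 0" "b \<noteq> 0"
  shows "push_letter ZZ (n, a) (push_letter ZZ (n, b) r) =
           (if a + b = 0 then r else push_letter ZZ (n, a + b) r)"
  using assms by (cases r; cases "tl r") (auto simp: reduced_Cons prod_eq_iff)

lemma foldr_push_push:
  assumes "reduced r" "snd a \<noteq> 0" "reduced xs"
  shows "foldr (push_letter ZZ) (push_letter ZZ a xs) r =
           push_letter ZZ a (foldr (push_letter ZZ) xs r)"
proof (cases xs)
  case (Cons b ys)
  have "reduced (foldr (push_letter ZZ) ys r)" "snd b \<noteq> 0"
    using assms Cons by (auto simp: reduced_Cons intro!: reduced_foldr_push reduced_nonzero_letters)
  from push_push_same[OF this(1), of "snd a" "snd b" "fst a"] this(2) assms(2) show ?thesis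
    by (cases a; cases b) (auto simp: Cons)
qed simp

text \<open>Van der Waerden's argument: letters act on reduced words by pushing, and a word acts in
  the same way as its reduced form. Associativity of \<open>FZ\<close> follows without comparing
  different orders of cancellation.\<close>

lemma foldr_push_reduce:
  assumes "reduced r" "nonzero_letters xs"
  shows "foldr (push_letter ZZ) (reduce ZZ xs) r = foldr (push_letter ZZ) xs r"
  using assms(2) by (induction xs) (auto simp: foldr_push_push assms(1) reduced_reduce)

lemma FZ_simps [simp]:
  "carrier FZ = {xs. reduced xs}"
  "\<one>\<^bsub>FZ\<^esub> = []"
  "xs \<otimes>\<^bsub>FZ\<^esub> ys = reduce ZZ (xs @ ys)"
  by (auto simp: FZ_def)

lemma reduce_append_FZ:
  assumes "nonzero_letters xs" "nonzero_letters ys"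
  shows "reduce ZZ (xs @ ys) = reduce ZZ xs \<otimes>\<^bsub>FZ\<^esub> reduce ZZ ys"
  using assms by (simp add: reduce_append foldr_push_reduce reduced_reduce reduce_reduced)

definition inv_letters :: "(nat \<times> int) list \<Rightarrow> (nat \<times> int) list" where
  "inv_letters xs = rev (map (\<lambda>a. (fst a, - snd a)) xs)"

lemma nonzero_letters_inv [simp]: "nonzero_letters (inv_letters xs) = nonzero_letters xs"
  by (auto simp: nonzero_letters_def inv_letters_def)

lemma foldr_push_inv_letters:
  assumes "reduced r" "nonzero_letters xs"
  shows "foldr (push_letter ZZ) (inv_letters xs) (foldr (push_letter ZZ) xs r) = r"
  using assms
proof (induction xs arbitrary: r)
  case (Cons a xs)
  have "reduced (foldr (push_letter ZZ) xs r)"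
    using Cons by (intro reduced_foldr_push) auto
  with push_push_same[OF this, of "- snd a" "snd a" "fst a"] Cons show ?case
    by (simp add: inv_letters_def)
qed (simp add: inv_letters_def)

lemma reduce_inv_letters_append:
  "nonzero_letters xs \<Longrightarrow> reduce ZZ (inv_letters xs @ xs) = []"
  using foldr_push_inv_letters[of "[]" xs] by (simp add: reduce_append) (simp add: reduce_def)

lemma group_FZ: "group FZ"
proof (rule groupI)
  fix x y z assume "x \<in> carrier FZ" "y \<in> carrier FZ" "z \<in> carrier FZ"
  then have n: "nonzero_letters x" "nonzero_letters y" "nonzero_letters z"
    and r: "reduced x" "reduced y" "reduced z" by (auto simp: reduced_nonzero_letters)
  show "x \<otimes>\<^bsub>FZ\<^esub> y \<otimes>\<^bsub>FZ\<^esub> z = x \<otimes>\<^bsub>FZ\<^esub> (y \<otimes>\<^bsub>FZ\<^esub> z)"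
    using reduce_append_FZ[of "x @ y" z] reduce_append_FZ[of x "y @ z"] n
    by (simp add: reduce_reduced r)
next
  fix x assume "x \<in> carrier FZ"
  then show "\<exists>y\<in>carrier FZ. y \<otimes>\<^bsub>FZ\<^esub> x = \<one>\<^bsub>FZ\<^esub>"
    using reduce_append_FZ[of "inv_letters x" x]
    by (intro bexI[of _ "reduce ZZ (inv_letters x)"])
       (auto simp: reduced_reduce reduced_nonzero_letters reduce_inv_letters_append reduce_reduced)
qed (auto simp: reduce_reduced reduced_nonzero_letters intro!: reduced_reduce)

interpretation FZ: group FZ by (rule group_FZ)

section \<open>Universal property of the free group and its retractions\<close>

definition gen :: "nat \<Rightarrow> (nat \<times> int) list" where "gen n = [(n, 1)]"

lemma gen_closed [simp, intro]: "gen n \<in> carrier FZ" by (simp add: gen_def reduced_Cons)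

lemma gen_reduced [simp]: "reduced (gen n)" by (simp add: gen_def reduced_Cons)

lemma int_pow_gen: "gen n [^]\<^bsub>FZ\<^esub> (z::int) = (if z = 0 then [] else [(n, z)])"
proof -
  define h where "h = (\<lambda>z::int. if z = 0 then [] else [(n, z)])"
  have h: "h \<in> hom integer_group FZ"
    by (auto simp: hom_def h_def reduced_Cons)
  have "h (1 [^]\<^bsub>integer_group\<^esub> z) = h 1 [^]\<^bsub>FZ\<^esub> z"
    by (intro hom_int_pow[OF h] group_FZ) simp_all
  then show ?thesis by (simp add: h_def gen_def)
qed

text \<open>The homomorphism out of the free group that sends \<open>gen n\<close> to
  \<open>f n\<close>. It is defined on all lists, so that invariance under reduction can be stated
  and gives multiplicativity.\<close>

definition eval :: "('a, 'b) monoid_scheme \<Rightarrow> (nat \<Rightarrow> 'a) \<Rightarrow> (nat \<times> int) list \<Rightarrow> 'a" where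
  "eval Q f xs = foldr (\<lambda>a y. (f (fst a) [^]\<^bsub>Q\<^esub> snd a) \<otimes>\<^bsub>Q\<^esub> y) xs \<one>\<^bsub>Q\<^esub>"

context group begin

context
  fixes f :: "nat \<Rightarrow> 'a"
  assumes f: "\<And>n. f n \<in> carrier G"
begin

lemma eval_simps [simp]:
  "eval G f [] = \<one>"
  "eval G f (a # xs) = (f (fst a) [^] snd a) \<otimes> eval G f xs"
  by (auto simp: eval_def)

lemma eval_closed [simp]: "eval G f xs \<in> carrier G"
  by (induction xs) (auto simp: f)

lemma eval_append: "eval G f (xs @ ys) = eval G f xs \<otimes> eval G f ys"
  by (induction xs) (auto simp: f m_assoc)

lemma eval_push_letter: "eval G f (push_letter ZZ a xs) = (f (fst a) [^] snd a) \<otimes> eval G f xs"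
proof (cases xs)
  case (Cons b ys)
  have "f (fst a) [^] snd a \<otimes> (f (fst a) [^] snd b \<otimes> eval G f ys) =
        f (fst a) [^] (snd a + snd b) \<otimes> eval G f ys"
    by (simp add: f int_pow_mult m_assoc)
  then show ?thesis by (auto simp: Cons f)
qed (simp add: f)

lemma eval_reduce: "eval G f (reduce ZZ xs) = eval G f xs"
  by (induction xs) (auto simp: eval_push_letter)

lemma eval_hom: "eval G f \<in> hom FZ G"
  by (auto simp: hom_def eval_append eval_reduce)

lemma eval_gen: "eval G f (gen n) = f n"
  by (simp add: gen_def f)

end

end

lemma generate_gen: "generate FZ (range gen) = carrier FZ"
proof
  show "generate FZ (range gen) \<subseteq> carrier FZ"
    by (rule FZ.generate_incl) auto
next
  show "carrier FZ \<subseteq> generate FZ (range gen)"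
  proof
    fix xs assume "xs \<in> carrier FZ"
    then have "reduced xs" by simp
    then show "xs \<in> generate FZ (range gen)"
    proof (induction xs)
      case Nil
      then show ?case using generate.one[of FZ] by simp
    next
      case (Cons a xs)
      have sub: "subgroup (generate FZ (range gen)) FZ"
        by (rule FZ.generate_is_subgroup) auto
      have "gen (fst a) [^]\<^bsub>FZ\<^esub> snd a \<in> generate FZ (range gen)"
        by (rule FZ.subgroup_int_pow_closed[OF sub]) (auto intro: generate.incl)
      then have "[a] \<in> generate FZ (range gen)"
        using Cons.prems by (simp add: int_pow_gen reduced_Cons)
      moreover have "a # xs = [a] \<otimes>\<^bsub>FZ\<^esub> xs"
        using Cons.prems reduce_reduced[of "a # xs"] by simp
      ultimately show ?case
        using Cons by (metis generate.eng reduced_Cons)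
    qed
  qed
qed

text \<open>The retraction killing the generators outside \<open>I\<close>. Coming from the
  universal property it is a homomorphism at once; \<open>restr_filter\<close> recovers its
  description as deletion of letters.\<close>

definition restr :: "nat set \<Rightarrow> (nat \<times> int) list \<Rightarrow> (nat \<times> int) list" where
  "restr I = eval FZ (\<lambda>n. if n \<in> I then gen n else [])"

lemma restr_hom: "restr I \<in> hom FZ FZ"
  unfolding restr_def by (rule FZ.eval_hom) auto

lemma restr_filter:
  assumes "nonzero_letters xs"
  shows "restr I (reduce ZZ xs) = reduce ZZ (filter (\<lambda>a. fst a \<in> I) xs)"
proof -
  have "restr I xs = reduce ZZ (filter (\<lambda>a. fst a \<in> I) xs)"
    using assms
  proof (induction xs)
    case (Cons a xs)
    have "reduced (reduce ZZ (filter (\<lambda>a. fst a \<in> I) xs))"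
      using Cons by (intro reduced_reduce) (auto simp: nonzero_letters_def)
    moreover have "([]::(nat \<times> int) list) [^]\<^bsub>FZ\<^esub> (z::int) = []" for z
      using FZ.int_pow_one[of z] by simp
    ultimately show ?case using Cons
      by (simp add: restr_def int_pow_gen reduce_reduced)
  qed (simp add: restr_def)
  then show ?thesis by (simp add: restr_def FZ.eval_reduce)
qed

declare FZ_simps [simp del]

section \<open>Signed words over the elements of a group\<close>

lemma freely_reduced_Nil [simp]: "freely_reduced []"
  by (simp add: freely_reduced_def)

lemma freely_reduced_Cons:
  "freely_reduced (a # ws) \<longleftrightarrow>
     freely_reduced ws \<and> (ws = [] \<or> fst a \<noteq> fst (hd ws) \<or> snd a = snd (hd ws))"
proof (cases ws)
  case (Cons b vs)
  have "freely_reduced (a # ws) \<longleftrightarrow>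
      (\<forall>i<length ws. \<not> (fst ((a # ws) ! i) = fst (ws ! i) \<and> snd ((a # ws) ! i) \<noteq> snd (ws ! i)))"
    by (auto simp: freely_reduced_def)
  also have "\<dots> \<longleftrightarrow> \<not> (fst a = fst (ws ! 0) \<and> snd a \<noteq> snd (ws ! 0)) \<and>
      (\<forall>i<length vs. \<not> (fst (ws ! i) = fst (ws ! Suc i) \<and> snd (ws ! i) \<noteq> snd (ws ! Suc i)))"
    by (simp add: Cons All_less_Suc2)
  finally show ?thesis by (auto simp: freely_reduced_def Cons)
qed (simp add: freely_reduced_def)

lemma freely_reduced_map:
  assumes "inj_on h (fst ` set ws)"
  shows "freely_reduced (map (apfst h) ws) = freely_reduced ws"
  using assms
proof (induction ws)
  case (Cons a ws)
  then show ?case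
    by (cases ws) (auto simp: freely_reduced_Cons inj_on_def)
qed simp

lemma eval_gword_Nil [simp]: "eval_gword G [] = \<one>\<^bsub>G\<^esub>"
  by (simp add: eval_gword_def)

lemma eval_gword_Cons [simp]:
  "eval_gword G (a # ws) = (if snd a then fst a else inv\<^bsub>G\<^esub> (fst a)) \<otimes>\<^bsub>G\<^esub> eval_gword G ws"
  by (simp add: eval_gword_def split: prod.split)

context group begin

lemma eval_gword_closed [simp]:
  "fst ` set ws \<subseteq> carrier G \<Longrightarrow> eval_gword G ws \<in> carrier G"
  by (induction ws) auto

lemma eval_gword_subgroup:
  assumes "subgroup L G" "fst ` set ws \<subseteq> L"
  shows "eval_gword (G\<lparr>carrier := L\<rparr>) ws = eval_gword G ws"
  using assms(2) by (induction ws) (auto simp: m_inv_consistent[OF assms(1)])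

lemma eval_gword_append:
  "fst ` set us \<subseteq> carrier G \<Longrightarrow> fst ` set ws \<subseteq> carrier G \<Longrightarrow>
     eval_gword G (us @ ws) = eval_gword G us \<otimes> eval_gword G ws"
  by (induction us) (auto simp: m_assoc)

lemma eval_gword_in_generate:
  "fst ` set ws \<subseteq> S \<Longrightarrow> eval_gword G ws \<in> generate G S"
  by (induction ws) (auto intro: generate.intros)

lemma eval_gword_freely_reduce:
  assumes "S \<subseteq> carrier G" "fst ` set ws \<subseteq> S"
  shows "\<exists>us. fst ` set us \<subseteq> S \<and> freely_reduced us \<and> eval_gword G us = eval_gword G ws"
  using assms(2)
proof (induction ws)
  case (Cons a ws)
  then obtain us where us: "fst ` set us \<subseteq> S" "freely_reduced us" "eval_gword G us = eval_gword G ws"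
    by auto
  show ?case
  proof (cases "us = [] \<or> fst a \<noteq> fst (hd us) \<or> snd a = snd (hd us)")
    case True
    then show ?thesis using us Cons.prems
      by (intro exI[of _ "a # us"]) (auto simp: freely_reduced_Cons)
  next
    case False
    then obtain b vs where b: "us = b # vs" "fst a = fst b" "snd a = (\<not> snd b)"
      by (cases us) auto
    have c: "fst b \<in> carrier G" "eval_gword G vs \<in> carrier G"
      using us(1) assms(1) b by auto
    have "eval_gword G vs = eval_gword G (a # ws)"
      using c by (auto simp: us(3)[symmetric] b m_assoc[symmetric])
    then show ?thesis using us b
      by (intro exI[of _ vs]) (auto simp: freely_reduced_Cons)
  qed
qed (intro exI[of _ "[]"], simp)

lemma generate_eval_gword:
  assumes "S \<subseteq> carrier G" "x \<in> generate G S"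
  obtains ws where "fst ` set ws \<subseteq> S" "freely_reduced ws" "x = eval_gword G ws"
proof -
  from assms(2) have "\<exists>ws. fst ` set ws \<subseteq> S \<and> x = eval_gword G ws"
  proof induction
    case one
    then show ?case by (intro exI[of _ "[]"]) auto
  next
    case (incl h)
    then show ?case using assms(1) by (intro exI[of _ "[(h, True)]"]) auto
  next
    case (inv h)
    then show ?case using assms(1) by (intro exI[of _ "[(h, False)]"]) auto
  next
    case (eng x y)
    then obtain us ws where u: "fst ` set us \<subseteq> S" "x = eval_gword G us"
      "fst ` set ws \<subseteq> S" "y = eval_gword G ws" by auto
    then have "x \<otimes> y = eval_gword G (us @ ws)"
      using assms(1) by (subst eval_gword_append) auto
    then show ?case using u by (intro exI[of _ "us @ ws"]) auto
  qed
  with eval_gword_freely_reduce[OF assms(1)] that show thesis by metis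
qed

end

lemma (in group_hom) hom_eval_gword:
  "fst ` set ws \<subseteq> carrier G \<Longrightarrow> h (eval_gword G ws) = eval_gword H (map (apfst h) ws)"
  by (induction ws) auto

section \<open>Nielsen's property modulo a normal subgroup\<close>

text \<open>The images of \<open>S\<close> in \<open>G / N\<close> are distinct and satisfy no
  relation; distinctness is included because s^-1 t is a reduced word for s different from t.
  Phrasing this inside \<open>G\<close> keeps the group fixed while \<open>N\<close> varies, so that
  limits become unions and intersections.\<close>

definition free_mod :: "('a, 'b) monoid_scheme \<Rightarrow> 'a set \<Rightarrow> 'a set \<Rightarrow> bool" where
  "free_mod G N S \<longleftrightarrow>
     (\<forall>ws. ws \<noteq> [] \<and> fst ` set ws \<subseteq> S \<and> freely_reduced ws \<longrightarrow> eval_gword G ws \<notin> N)"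

text \<open>Local freeness of \<open>G / N\<close> alone does not survive the limits needed below; this strengthening,
  which contains the Hopf property of finitely generated free groups, does.\<close>

definition nielsen :: "('a, 'b) monoid_scheme \<Rightarrow> 'a set \<Rightarrow> bool" where
  "nielsen G N \<longleftrightarrow>
     (\<forall>S. finite S \<and> S \<subseteq> carrier G \<longrightarrow>
        free_mod G N S \<or>
        (\<exists>T. finite T \<and> T \<subseteq> carrier G \<and> card T < card S \<and> generate G (T \<union> N) = generate G (S \<union> N)))"

text \<open>The least number of generators of the image of <S> in \<open>G / N\<close>. The
  competing sets \<open>T\<close> lie in <S>N and not necessarily in <S>, which is what
  \<open>nielsen_INT\<close> later has to repair.\<close>

definition rank_mod :: "('a, 'b) monoid_scheme \<Rightarrow> 'a set \<Rightarrow> 'a set \<Rightarrow> nat" where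
  "rank_mod G N S =
     (LEAST k. \<exists>T. finite T \<and> T \<subseteq> carrier G \<and> card T = k \<and> generate G (T \<union> N) = generate G (S \<union> N))"

lemma nielsenE:
  assumes "nielsen G N" "finite S" "S \<subseteq> carrier G" "\<not> free_mod G N S"
  obtains T where "finite T" "T \<subseteq> carrier G" "card T < card S"
    "generate G (T \<union> N) = generate G (S \<union> N)"
  using assms(1)[unfolded nielsen_def, rule_format, of S] assms(2-4) by auto

lemma free_mod_mono: "free_mod G N S \<Longrightarrow> M \<subseteq> N \<Longrightarrow> free_mod G M S"
  by (auto simp: free_mod_def)

context group begin

lemma generate_Un_normal:
  assumes N: "N \<lhd> G" and S: "S \<subseteq> carrier G" and x: "x \<in> generate G (S \<union> N)"
  obtains t n where "t \<in> generate G S" "n \<in> N" "x = t \<otimes> n"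
proof -
  interpret N: normal N G by (rule N)
  have gS: "t \<in> generate G S \<Longrightarrow> t \<in> carrier G" for t
    using generate_incl[OF S] by auto
  from x have "\<exists>t\<in>generate G S. \<exists>n\<in>N. x = t \<otimes> n"
  proof induction
    case one
    then show ?case by (intro bexI[of _ \<one>]) (auto intro: generate.one)
  next
    case (incl h)
    then show ?case
    proof
      assume "h \<in> S" then show ?thesis using S
        by (intro bexI[of _ h] bexI[of _ \<one>]) (auto intro: generate.incl)
    next
      assume "h \<in> N" then show ?thesis
        by (intro bexI[of _ \<one>] bexI[of _ h]) (auto intro: generate.one)
    qed
  next
    case (inv h)
    then show ?case
    proof
      assume "h \<in> S" then show ?thesis using S
        by (intro bexI[of _ "inv h"] bexI[of _ \<one>]) (auto intro: generate.inv)
    next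
      assume "h \<in> N" then show ?thesis
        by (intro bexI[of _ \<one>] bexI[of _ "inv h"]) (auto intro: generate.one)
    qed
  next
    case (eng x y)
    then obtain s m t n where st: "s \<in> generate G S" "m \<in> N" "x = s \<otimes> m"
      "t \<in> generate G S" "n \<in> N" "y = t \<otimes> n" by auto
    have "inv t \<otimes> m \<otimes> t \<in> N" using N.inv_op_closed1[of t m] st gS by auto
    moreover have "x \<otimes> y = s \<otimes> t \<otimes> (inv t \<otimes> m \<otimes> t \<otimes> n)"
    proof -
      have c: "s \<in> carrier G" "t \<in> carrier G" "m \<in> carrier G" "n \<in> carrier G"
        using st gS by auto
      then have "t \<otimes> (inv t \<otimes> (m \<otimes> (t \<otimes> n))) = m \<otimes> (t \<otimes> n)"
        by (simp add: m_assoc[symmetric])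
      with c show ?thesis by (simp add: st m_assoc)
    qed
    ultimately show ?case
      using st by (intro bexI[of _ "s \<otimes> t"] bexI[of _ "inv t \<otimes> m \<otimes> t \<otimes> n"]) (auto intro: generate.eng)
  qed
  with that show thesis by blast
qed

lemma generate_Un_one: "A \<subseteq> carrier G \<Longrightarrow> generate G (A \<union> {\<one>}) = generate G A"
  by (intro equalityI generate_subgroup_incl generate_is_subgroup mono_generate)
    (auto intro: generate.intros)

lemma generate_Un_subset_iff:
  assumes "S \<subseteq> carrier G" "N \<subseteq> carrier G" "T \<subseteq> carrier G"
  shows "generate G (S \<union> N) \<subseteq> generate G (T \<union> N) \<longleftrightarrow> S \<subseteq> generate G (T \<union> N)"
proof
  assume "generate G (S \<union> N) \<subseteq> generate G (T \<union> N)"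
  then show "S \<subseteq> generate G (T \<union> N)" by (auto intro: generate.incl)
next
  assume "S \<subseteq> generate G (T \<union> N)"
  then show "generate G (S \<union> N) \<subseteq> generate G (T \<union> N)"
    using assms by (intro generate_subgroup_incl generate_is_subgroup) (auto intro: generate.incl)
qed

lemma generate_Un_mono:
  assumes "S \<subseteq> carrier G" "M \<subseteq> carrier G" "T \<subseteq> carrier G" "N \<subseteq> M"
    and eq: "generate G (T \<union> N) = generate G (S \<union> N)"
  shows "generate G (T \<union> M) = generate G (S \<union> M)"
proof -
  have "generate G (T \<union> N) \<subseteq> generate G (T \<union> M)" "generate G (S \<union> N) \<subseteq> generate G (S \<union> M)"
    using assms(4) by (auto intro!: mono_generate)
  moreover have "T \<subseteq> generate G (T \<union> N)" "S \<subseteq> generate G (S \<union> N)" by (auto intro: generate.incl)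
  ultimately have "T \<subseteq> generate G (S \<union> M)" "S \<subseteq> generate G (T \<union> M)" using eq by auto
  then show ?thesis using assms generate_Un_subset_iff by (metis subset_antisym)
qed

lemma rank_mod_witness:
  assumes "finite S" "S \<subseteq> carrier G"
  obtains T where "finite T" "T \<subseteq> carrier G" "card T = rank_mod G N S"
    "generate G (T \<union> N) = generate G (S \<union> N)"
proof -
  have "\<exists>k T. finite T \<and> T \<subseteq> carrier G \<and> card T = k \<and> generate G (T \<union> N) = generate G (S \<union> N)"
    using assms by blast
  from LeastI_ex[OF this] show thesis using that unfolding rank_mod_def by blast
qed

lemma rank_mod_le:
  assumes "finite T" "T \<subseteq> carrier G" "generate G (T \<union> N) = generate G (S \<union> N)"
  shows "rank_mod G N S \<le> card T"
  unfolding rank_mod_def using assms by (intro Least_le) blast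

lemma rank_mod_antimono:
  assumes "finite S" "S \<subseteq> carrier G" "M \<subseteq> carrier G" "N \<subseteq> M"
  shows "rank_mod G M S \<le> rank_mod G N S"
proof -
  obtain T where "finite T" "T \<subseteq> carrier G" "card T = rank_mod G N S"
    "generate G (T \<union> N) = generate G (S \<union> N)" using rank_mod_witness assms by metis
  then show ?thesis using rank_mod_le[of T M S] generate_Un_mono[of S M T N] assms by metis
qed

text \<open>If \<open>T\<close> were not free, Nielsen's property would produce fewer generators
  than the rank.\<close>

lemma minimal_free_mod:
  assumes "nielsen G M" "finite T" "T \<subseteq> carrier G" "card T = rank_mod G M S"
    and eq: "generate G (T \<union> M) = generate G (S \<union> M)"
  shows "free_mod G M T"
proof (rule ccontr)
  assume "\<not> free_mod G M T"
  then obtain U where "finite U" "U \<subseteq> carrier G" "card U < card T"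
    "generate G (U \<union> M) = generate G (T \<union> M)"
    using nielsenE[OF assms(1-3)] by auto
  with rank_mod_le[of U M S] assms show False by simp
qed

text \<open>The Hopf property in relative form: equal ranks make the map from \<open>G / N\<close>
  to \<open>G / M\<close> injective on the image of \<open>S\<close>. A set \<open>T\<close> that is
  minimal modulo \<open>N\<close> is also minimal, hence free, modulo \<open>M\<close>. Up to a
  factor in \<open>N\<close>, an element of the intersection is a reduced word in \<open>T\<close>
  lying in \<open>M\<close>, so that word is empty.\<close>

lemma rank_mod_eq_Int:
  assumes N: "N \<lhd> G" and M: "M \<lhd> G" and NM: "N \<subseteq> M" and nie: "nielsen G M"
    and S: "finite S" "S \<subseteq> carrier G" and rank: "rank_mod G N S = rank_mod G M S"
  shows "generate G (S \<union> N) \<inter> M \<subseteq> N"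
proof
  fix x assume x: "x \<in> generate G (S \<union> N) \<inter> M"
  interpret N: normal N G by (rule N)
  interpret M: normal M G by (rule M)
  obtain T where T: "finite T" "T \<subseteq> carrier G" "card T = rank_mod G N S"
    "generate G (T \<union> N) = generate G (S \<union> N)" using rank_mod_witness S by metis
  have "generate G (T \<union> M) = generate G (S \<union> M)"
    using generate_Un_mono[of S M T N] T S NM M.subset by auto
  then have free: "free_mod G M T"
    using minimal_free_mod[OF nie, of T S] T rank by simp
  obtain t n where t: "t \<in> generate G T" "n \<in> N" "x = t \<otimes> n"
    using generate_Un_normal[OF N, of T x] T x by auto
  obtain ws where ws: "fst ` set ws \<subseteq> T" "freely_reduced ws" "t = eval_gword G ws"
    using generate_eval_gword[OF T(2) t(1)] by metis
  have tc: "t \<in> carrier G" "n \<in> carrier G" using t generate_incl[OF T(2)] by auto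
  have "t = x \<otimes> inv n" using tc t by (simp add: m_assoc)
  then have "t \<in> M" using x t(2) NM by auto
  then have "ws = []" using free ws unfolding free_mod_def by auto
  then show "x \<in> N" using t ws tc by simp
qed

text \<open>The ranks decrease, so they are constant from some stage \<open>k\<close> on, and beyond
  it nothing new of <S> is killed. Both alternatives at stage \<open>k\<close> therefore pass to the
  union: freeness because words in \<open>S\<close> meet the union only inside \<open>N k\<close>, a
  smaller generating set because it still generates modulo more.\<close>

lemma nielsen_UN:
  fixes N :: "nat \<Rightarrow> 'a set"
  assumes N: "\<And>n. N n \<lhd> G" and mono: "\<And>n. N n \<subseteq> N (Suc n)" and nie: "\<And>n. nielsen G (N n)"
  shows "nielsen G (\<Union>n. N n)"
  unfolding nielsen_def
proof (intro allI impI)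
  fix S assume S: "finite S \<and> S \<subseteq> carrier G"
  have Nc: "N n \<subseteq> carrier G" for n
    using N normal_imp_subgroup subgroup.subset by blast
  have mono': "m \<le> n \<Longrightarrow> N m \<subseteq> N n" for m n by (rule lift_Suc_mono_le[of N, OF mono])
  obtain k where k: "\<And>n. rank_mod G (N k) S \<le> rank_mod G (N n) S"
    using ex_has_least_nat[of "\<lambda>_. True" 0 "\<lambda>n. rank_mod G (N n) S"] by auto
  have eq: "rank_mod G (N k) S = rank_mod G (N n) S" if "n \<ge> k" for n
    using k[of n] rank_mod_antimono[of S "N n" "N k"] S Nc mono'[OF that] by auto
  have sub: "generate G (S \<union> N k) \<inter> (\<Union>n. N n) \<subseteq> N k"
  proof
    fix x assume x: "x \<in> generate G (S \<union> N k) \<inter> (\<Union>n. N n)"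
    then obtain n where "x \<in> N n" by auto
    then have "x \<in> N (max k n)" using mono'[of n "max k n"] by auto
    with rank_mod_eq_Int[OF N N mono'[of k "max k n"] nie] eq[of "max k n"] S x
    show "x \<in> N k" by auto
  qed
  show "free_mod G (\<Union>n. N n) S \<or> (\<exists>T. finite T \<and> T \<subseteq> carrier G \<and> card T < card S \<and>
      generate G (T \<union> (\<Union>n. N n)) = generate G (S \<union> (\<Union>n. N n)))"
  proof (cases "free_mod G (N k) S")
    case True
    have "eval_gword G ws \<in> generate G (S \<union> N k)" if "fst ` set ws \<subseteq> S" for ws
      using that by (intro eval_gword_in_generate) auto
    with True sub have "free_mod G (\<Union>n. N n) S"
      unfolding free_mod_def by blast
    then show ?thesis ..
  next
    case False
    then obtain T where "finite T" "T \<subseteq> carrier G" "card T < card S"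
       "generate G (T \<union> N k) = generate G (S \<union> N k)" using nielsenE[OF nie[of k], of S] S by auto
    with generate_Un_mono[of S "\<Union>n. N n" T "N k"] Nc S show ?thesis by blast
  qed
qed

text \<open>Here the ranks grow, but they are bounded by \<open>card S\<close>. Freeness passes down
  to the intersection at once; the difficulty is that a smaller set generating modulo
  \<open>N k\<close> has to be corrected so that it generates modulo the intersection.\<close>

lemma nielsen_INT:
  fixes N :: "nat \<Rightarrow> 'a set"
  assumes N: "\<And>n. N n \<lhd> G" and anti: "\<And>n. N (Suc n) \<subseteq> N n" and nie: "\<And>n. nielsen G (N n)"
  shows "nielsen G (\<Inter>n. N n)"
  unfolding nielsen_def
proof (intro allI impI)
  fix S assume S: "finite S \<and> S \<subseteq> carrier G"
  have Nc: "N n \<subseteq> carrier G" for n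
    using N normal_imp_subgroup subgroup.subset by blast
  have anti': "m \<le> n \<Longrightarrow> N n \<subseteq> N m" for m n by (rule lift_Suc_antimono_le[of N, OF anti])
  have bound: "rank_mod G (N n) S \<le> card S" for n
    using rank_mod_le[of S] S by auto
  obtain k where k: "\<And>n. rank_mod G (N n) S \<le> rank_mod G (N k) S"
    using ex_has_greatest_nat[of "\<lambda>_. True" 0 "\<lambda>n. rank_mod G (N n) S" "Suc (card S)"] bound
    by (auto simp: less_Suc_eq_le)
  have eq: "rank_mod G (N n) S = rank_mod G (N k) S" if "n \<ge> k" for n
    using k[of n] rank_mod_antimono[of S "N k" "N n"] S Nc anti'[OF that] by auto
  have sub: "generate G S \<inter> N k \<subseteq> (\<Inter>n. N n)"
  proof
    fix x assume x: "x \<in> generate G S \<inter> N k"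
    have "x \<in> N n" if "n \<ge> k" for n
    proof -
      have "x \<in> generate G (S \<union> N n)" using x mono_generate[of S "S \<union> N n"] by auto
      with rank_mod_eq_Int[OF N N anti'[OF that] nie] eq[OF that] S x show ?thesis by auto
    qed
    then have "x \<in> N n" for n using anti'[of n "max k n"] by (meson max.cobounded1 max.cobounded2 subsetD)
    then show "x \<in> (\<Inter>n. N n)" by auto
  qed
  show "free_mod G (\<Inter>n. N n) S \<or> (\<exists>T. finite T \<and> T \<subseteq> carrier G \<and> card T < card S \<and>
      generate G (T \<union> (\<Inter>n. N n)) = generate G (S \<union> (\<Inter>n. N n)))"
  proof (cases "free_mod G (N k) S")
    case True
    then show ?thesis using free_mod_mono[of G "N k" S "\<Inter>n. N n"] by auto
  next
    case False
    then obtain T where T: "finite T" "T \<subseteq> carrier G" "card T < card S"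
       "generate G (T \<union> N k) = generate G (S \<union> N k)" using nielsenE[OF nie[of k], of S] S by auto
    \<comment> \<open>Each element of \<open>T\<close> is moved by a factor in \<open>N k\<close>
      into <S>. Only then can \<open>sub\<close> be applied to the errors that arise below.\<close>
    have "\<exists>u. u \<in> generate G S \<and> (\<exists>n\<in>N k. t = u \<otimes> n)" if "t \<in> T" for t
    proof -
      have "t \<in> generate G (S \<union> N k)" unfolding T(4)[symmetric] using that by (auto intro: generate.incl)
      then obtain v n where "v \<in> generate G S" "n \<in> N k" "t = v \<otimes> n"
        using generate_Un_normal[OF N[of k], of S t] S by auto
      then show ?thesis by blast
    qed
    then obtain u where u: "\<And>t. t \<in> T \<Longrightarrow> u t \<in> generate G S" "\<And>t. t \<in> T \<Longrightarrow> \<exists>n\<in>N k. t = u t \<otimes> n"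
      by metis
    define U where "U = u ` T"
    have U: "U \<subseteq> generate G S" "finite U" "card U < card S"
      using u T by (auto simp: U_def intro: le_less_trans[OF card_image_le])
    then have Uc: "U \<subseteq> carrier G" using generate_incl[of S] S by auto
    have "T \<subseteq> generate G (U \<union> N k)"
    proof
      fix t assume t: "t \<in> T"
      then obtain n where "n \<in> N k" "t = u t \<otimes> n" using u(2) by blast
      moreover have "u t \<in> U" using t by (simp add: U_def)
      ultimately show "t \<in> generate G (U \<union> N k)" by (metis UnCI generate.eng generate.incl)
    qed
    then have "generate G (S \<union> N k) \<subseteq> generate G (U \<union> N k)"
      using generate_Un_subset_iff[of T "N k" U] T Uc Nc by auto
    then have SU: "S \<subseteq> generate G (U \<union> N k)" by (auto intro: generate.incl)
    have "S \<subseteq> generate G (U \<union> (\<Inter>n. N n))"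
    proof
      fix s assume s: "s \<in> S"
      then obtain t n where tn: "t \<in> generate G U" "n \<in> N k" "s = t \<otimes> n"
        using generate_Un_normal[OF N[of k] Uc, of s] SU by auto
      have c: "t \<in> carrier G" "n \<in> carrier G" using tn Nc generate_incl[OF Uc] by auto
      have tS: "t \<in> generate G S"
        using tn(1) generate_subgroup_incl[OF U(1)] generate_is_subgroup S by blast
      \<comment> \<open>The error \<open>n\<close> is a quotient of two elements of <S>, so it lies
        in <S> as well as in \<open>N k\<close>, and hence in every \<open>N n\<close>.\<close>
      have "n = inv t \<otimes> s" using c tn by (simp add: m_assoc[symmetric])
      also have "\<dots> \<in> generate G S"
        using tS s S by (intro generate.eng generate_m_inv_closed) (auto intro: generate.incl)
      finally have "n \<in> (\<Inter>n. N n)" using sub tn by auto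
      then have "n \<in> generate G (U \<union> (\<Inter>n. N n))" by (intro generate.incl) auto
      moreover have "t \<in> generate G (U \<union> (\<Inter>n. N n))" using tn(1) mono_generate[of U] by blast
      ultimately show "s \<in> generate G (U \<union> (\<Inter>n. N n))" using tn(3) generate.eng by metis
    qed
    moreover have "U \<subseteq> generate G (S \<union> (\<Inter>n. N n))"
      using U(1) mono_generate[of S] by blast
    moreover have "(\<Inter>n. N n) \<subseteq> carrier G" using Nc by auto
    ultimately have "generate G (U \<union> (\<Inter>n. N n)) = generate G (S \<union> (\<Inter>n. N n))"
      using generate_Un_subset_iff S Uc by (metis subset_antisym)
    then show ?thesis using U Uc by blast
  qed
qed

end

text \<open>The smaller generating set found in \<open>H\<close> lies in the subgroup generated by
  the image of \<open>S\<close>, so it lifts into <S> even when \<open>h\<close> is not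
  onto.\<close>

lemma (in group_hom) nielsen_kernel:
  assumes nie: "nielsen H {\<one>\<^bsub>H\<^esub>}"
  shows "nielsen G (kernel G H h)"
  unfolding nielsen_def
proof (intro allI impI)
  fix S assume S: "finite S \<and> S \<subseteq> carrier G"
  let ?K = "kernel G H h"
  have Kc: "?K \<subseteq> carrier G" by (auto simp: kernel_def)
  have transfer: "generate G (U \<union> ?K) \<subseteq> generate G (S' \<union> ?K)"
    if U: "U \<subseteq> carrier G" "S' \<subseteq> carrier G" "h ` U \<subseteq> generate H (h ` S')" for U S'
  proof -
    have "U \<subseteq> generate G (S' \<union> ?K)"
    proof
      fix x assume x: "x \<in> U"
      then obtain y where y: "y \<in> generate G S'" "h x = h y"
        using U generate_img[OF U(2)] by blast
      have c: "x \<in> carrier G" "y \<in> carrier G" using x y U G.generate_incl[OF U(2)] by auto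
      have "inv y \<otimes> x \<in> ?K" using c y by (auto simp: kernel_def)
      then have "y \<otimes> (inv y \<otimes> x) \<in> generate G (S' \<union> ?K)"
        using y(1) G.mono_generate[of S' "S' \<union> ?K"]
        by (intro generate.eng[of y]) (auto intro: generate.incl)
      then show "x \<in> generate G (S' \<union> ?K)" using c by (simp add: G.m_assoc[symmetric])
    qed
    then show ?thesis using G.generate_Un_subset_iff[OF U(1) Kc U(2)] by simp
  qed
  show "free_mod G ?K S \<or> (\<exists>T. finite T \<and> T \<subseteq> carrier G \<and> card T < card S \<and>
      generate G (T \<union> ?K) = generate G (S \<union> ?K))"
  proof (cases "inj_on h S \<and> free_mod H {\<one>\<^bsub>H\<^esub>} (h ` S)")
    case True
    have "eval_gword G ws \<notin> ?K" if ws: "ws \<noteq> []" "fst ` set ws \<subseteq> S" "freely_reduced ws" for ws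
    proof -
      have "inj_on h (fst ` set ws)" using True ws inj_on_subset by blast
      then have "freely_reduced (map (apfst h) ws)" using ws freely_reduced_map by blast
      moreover have "fst ` set (map (apfst h) ws) \<subseteq> h ` S" using ws by auto
      ultimately have "eval_gword H (map (apfst h) ws) \<noteq> \<one>\<^bsub>H\<^esub>"
        using True ws(1) unfolding free_mod_def by blast
      moreover have "fst ` set ws \<subseteq> carrier G" using ws S by auto
      ultimately show ?thesis using hom_eval_gword[of ws] by (auto simp: kernel_def)
    qed
    then show ?thesis by (auto simp: free_mod_def)
  next
    case False
    have fin: "finite (h ` S)" "h ` S \<subseteq> carrier H" using S by auto
    have "\<exists>T. finite T \<and> T \<subseteq> carrier H \<and> card T < card S \<and> generate H T = generate H (h ` S)"
    \<comment> \<open>If \<open>h\<close> identifies two elements of \<open>S\<close>, the image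
      itself is already the smaller generating set.\<close>
    proof (cases "inj_on h S")
      case True
      then obtain T where "finite T" "T \<subseteq> carrier H" "card T < card (h ` S)"
        "generate H (T \<union> {\<one>\<^bsub>H\<^esub>}) = generate H (h ` S \<union> {\<one>\<^bsub>H\<^esub>})"
        using False nielsenE[OF nie fin] by auto
      then show ?thesis using H.generate_Un_one fin True by (auto simp: card_image)
    next
      case False
      then have "card (h ` S) < card S"
        using S by (meson card_image_le eq_card_imp_inj_on order_le_imp_less_or_eq)
      then show ?thesis using fin by blast
    qed
    then obtain T where T: "finite T" "T \<subseteq> carrier H" "card T < card S"
      "generate H T = generate H (h ` S)" by blast
    have "T \<subseteq> h ` generate G S"
      using T(4) generate_img[of S] S by (auto intro: generate.incl)
    \<comment> \<open>Choosing one preimage for each element of \<open>T\<close> keeps the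
      cardinality.\<close>
    then obtain U where U: "U \<subseteq> generate G S" "inj_on h U" "T = h ` U"
      by (auto simp: subset_image_inj)
    have Uc: "U \<subseteq> carrier G" using U G.generate_incl[of S] S by auto
    have cardU: "finite U" "card U < card S"
      using T U by (auto simp: card_image finite_image_iff)
    have "T \<subseteq> generate H T" "h ` S \<subseteq> generate H (h ` S)"
      by (auto intro: generate.incl)
    then have "h ` U \<subseteq> generate H (h ` S)" "h ` S \<subseteq> generate H (h ` U)"
      using T(4) U(3) by auto
    then show ?thesis using transfer[of U S] transfer[of S U] Uc cardU S by blast
  qed
qed

section \<open>Nielsen's property of free groups\<close>

lemma carrier_BijGroup: "carrier (BijGroup S) = Bij S"
  by (simp add: BijGroup_def)

lemma BijGroup_mult_apply:
  "p \<in> Bij S \<Longrightarrow> r \<in> Bij S \<Longrightarrow> x \<in> S \<Longrightarrow> (p \<otimes>\<^bsub>BijGroup S\<^esub> r) x = p (r x)"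
  by (simp add: BijGroup_def compose_def)

lemma BijGroup_one_apply: "x \<in> S \<Longrightarrow> \<one>\<^bsub>BijGroup S\<^esub> x = x"
  by (simp add: BijGroup_def)

lemma Bij_apply_in: "p \<in> Bij S \<Longrightarrow> x \<in> S \<Longrightarrow> p x \<in> S"
  by (auto dest: Bij_imp_funcset)

lemma BijGroup_inv_apply:
  "p \<in> Bij S \<Longrightarrow> x \<in> S \<Longrightarrow> p x = y \<Longrightarrow> (inv\<^bsub>BijGroup S\<^esub> p) y = x"
  by (auto simp: inv_BijGroup Bij_apply_in Bij_def bij_betw_def)

lemma finite_Bij: "finite S \<Longrightarrow> finite (Bij S)"
  by (rule finite_subset[of _ "S \<rightarrow>\<^sub>E S"])
     (auto simp: Bij_apply_in intro!: finite_PiE dest: Bij_imp_extensional extensional_arb)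

text \<open>The complements of domain and range have the same finite cardinality, so a bijection
  between them completes \<open>g\<close>.\<close>

lemma inj_on_extend_Bij:
  assumes "finite S" "D \<subseteq> S" "inj_on g D" "g ` D \<subseteq> S"
  shows "\<exists>p\<in>Bij S. \<forall>x\<in>D. p x = g x"
proof -
  have "card (S - D) = card (S - g ` D)"
    using assms by (simp add: card_Diff_subset finite_subset card_image)
  then obtain r where r: "bij_betw r (S - D) (S - g ` D)"
    using finite_same_card_bij[of "S - D" "S - g ` D"] assms(1) by auto
  define p where "p = (\<lambda>x\<in>S. if x \<in> D then g x else r x)"
  have "bij_betw p D (g ` D) = bij_betw g D (g ` D)"
    using assms(2) by (intro bij_betw_cong) (auto simp: p_def)
  moreover have "bij_betw p (S - D) (S - g ` D) = bij_betw r (S - D) (S - g ` D)"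
    by (intro bij_betw_cong) (auto simp: p_def)
  ultimately have "bij_betw p D (g ` D)" "bij_betw p (S - D) (S - g ` D)"
    using assms(3) r by (simp_all add: bij_betw_def)
  from bij_betw_combine[OF this] have "bij_betw p S S"
    using assms(2,4) by (simp add: Un_absorb1)
  then show ?thesis using assms(2) by (intro bexI[of _ p]) (auto simp: p_def Bij_def subset_iff)
qed

text \<open>The permutations send the point \<open>length ws\<close> down to \<open>0\<close> one step per letter;
  free reducedness is exactly what makes these prescriptions consistent.\<close>

lemma freely_reduced_residually_finite:
  assumes fr: "freely_reduced ws" and ne: "ws \<noteq> []"
  obtains f where "\<And>x. f x \<in> Bij {..length ws}"
    "eval_gword (BijGroup {..length ws}) (map (apfst f) ws) \<noteq> \<one>\<^bsub>BijGroup {..length ws}\<^esub>"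
proof -
  define N where "N = length ws"
  let ?Q = "BijGroup {..N}"
  \<comment> \<open>A letter \<open>(x, True)\<close> at position \<open>j - 1\<close> demands that
    \<open>x\<close> send \<open>j\<close> to \<open>j - 1\<close>. A letter
    \<open>(x, False)\<close> at position \<open>j\<close> demands that \<open>x\<close> send
    \<open>j\<close> to \<open>Suc j\<close>, so that its inverse goes one step down.
    \<open>D x\<close> collects the points where some demand on \<open>x\<close> is made.\<close>
  define g where "g = (\<lambda>x j. if 0 < j \<and> ws ! (j - 1) = (x, True) then j - 1 else Suc j)"
  define D where "D = (\<lambda>x. {j. j \<le> N \<and> (0 < j \<and> ws ! (j - 1) = (x, True) \<or> j < N \<and> ws ! j = (x, False))})"
  \<comment> \<open>This excludes both conflicts: two demands at the same point, and two points sent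
    to the same target.\<close>
  have clash: "\<not> (ws ! i = (x, b) \<and> ws ! Suc i = (x, \<not> b))" if "Suc i < N" for i x b
    using fr that unfolding freely_reduced_def N_def by fastforce
  have "\<exists>p\<in>Bij {..N}. \<forall>j\<in>D x. p j = g x j" for x
  proof (rule inj_on_extend_Bij)
    show "g x ` D x \<subseteq> {..N}" by (auto simp: g_def D_def)
    show "inj_on (g x) (D x)"
    proof (rule inj_onI)
      fix i j assume ij: "i \<in> D x" "j \<in> D x" "g x i = g x j"
      show "i = j"
        using ij clash[of "i - 2" x False] clash[of "j - 2" x False] clash[of i x False] clash[of j x False]
        by (auto simp: g_def D_def split: if_splits)
    qed
  qed (auto simp: D_def)
  then obtain f where f: "\<And>x. f x \<in> Bij {..N}" "\<And>x j. j \<in> D x \<Longrightarrow> f x j = g x j" by metis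
  interpret Q: group ?Q by (rule group_BijGroup)
  have closed: "eval_gword ?Q (map (apfst f) us) \<in> Bij {..N}" for us
  proof -
    have "fst ` set (map (apfst f) us) \<subseteq> carrier ?Q" using f(1) by (auto simp: carrier_BijGroup)
    from Q.eval_gword_closed[OF this] show ?thesis by (simp add: carrier_BijGroup)
  qed
  have fc: "inv\<^bsub>?Q\<^esub> (f x) \<in> Bij {..N}" for x
    using f(1) Q.inv_closed by (simp add: carrier_BijGroup)
  have "eval_gword ?Q (map (apfst f) (drop i ws)) N = i" if "i \<le> N" for i
    using that
  proof (induction "N - i" arbitrary: i)
    case 0
    then show ?case by (simp add: N_def BijGroup_one_apply)
  next
    case (Suc k)
    obtain x b where xb: "ws ! i = (x, b)" by fastforce
    have i: "i < N" "drop i ws = ws ! i # drop (Suc i) ws"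
      using Suc by (auto simp: N_def Cons_nth_drop_Suc)
    have IH: "eval_gword ?Q (map (apfst f) (drop (Suc i) ws)) N = Suc i"
      using Suc i by (intro Suc(1)) auto
    show ?case
    proof (cases b)
      case True
      have "f x (Suc i) = i" using xb True i by (subst f(2)) (auto simp: D_def g_def)
      then show ?thesis using True IH by (simp add: i xb BijGroup_mult_apply closed f)
    next
      case False
      have "\<not> (0 < i \<and> ws ! (i - 1) = (x, True))"
        using clash[of "i - 1" x True] xb False i by auto
      then have "f x i = Suc i" using xb False i by (subst f(2)) (auto simp: D_def g_def)
      then have "(inv\<^bsub>?Q\<^esub> (f x)) (Suc i) = i"
        using BijGroup_inv_apply[OF f(1)] i by auto
      then show ?thesis using False IH by (simp add: i xb BijGroup_mult_apply closed fc)
    qed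
  qed
  from this[of 0] have "eval_gword ?Q (map (apfst f) ws) N \<noteq> N"
    using ne by (simp add: N_def)
  then have "eval_gword ?Q (map (apfst f) ws) \<noteq> \<one>\<^bsub>?Q\<^esub>" by (auto simp: BijGroup_one_apply)
  then show thesis using f(1) by (intro that[of f]) (simp_all add: N_def)
qed

section \<open>Counting homomorphisms into finite groups\<close>

lemma hom_eq_on_generate:
  assumes "group G" "group Q" "subgroup L G" "h \<in> hom (G\<lparr>carrier := L\<rparr>) Q" "k \<in> hom (G\<lparr>carrier := L\<rparr>) Q"
    "S \<subseteq> L" "\<And>s. s \<in> S \<Longrightarrow> h s = k s" "x \<in> generate G S"
  shows "h x = k x"
proof -
  interpret G: group G by fact
  interpret h: group_hom "G\<lparr>carrier := L\<rparr>" Q h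
    using assms by (intro group_hom.intro group_hom_axioms.intro subgroup.subgroup_is_group)
  interpret k: group_hom "G\<lparr>carrier := L\<rparr>" Q k
    using assms by (intro group_hom.intro group_hom_axioms.intro subgroup.subgroup_is_group)
  have "x \<in> generate (G\<lparr>carrier := L\<rparr>) S"
    using G.generate_consistent[OF assms(6,3)] assms(8) by simp
  then show ?thesis
  proof induction
    case one
    show ?case using h.hom_one k.hom_one by simp
  next
    case (incl s) then show ?case using assms by blast
  next
    case (inv s) then show ?case using assms(6,7) h.hom_inv[of s] k.hom_inv[of s] by auto
  next
    case (eng s t)
    then have "s \<in> L" "t \<in> L"
      using h.G.generate_in_carrier[of S] assms(6) by auto
    then show ?case using eng h.hom_mult[of s t] k.hom_mult[of s t] by simp
  qed
qed

text \<open>Homomorphisms from \<open>L\<close> to a finite group \<open>Q\<close> are counted twice: there are at least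
  \<open>card Q ^ card B\<close> of them by extension from \<open>B\<close>, and at most \<open>card Q ^ card S\<close> because
  \<open>S\<close> generates.  In the case of equality every map \<open>S \<rightarrow> Q\<close> extends, so
  residual finiteness makes \<open>S\<close> free.\<close>

lemma (in group) extension_basis_card:
  assumes S: "finite S" "S \<subseteq> carrier G" and B: "B \<subseteq> generate G S"
    and ext: "\<And>(Q :: (nat \<Rightarrow> nat) monoid) f. group Q \<Longrightarrow> f \<in> B \<rightarrow> carrier Q \<Longrightarrow>
       \<exists>h\<in>hom (G\<lparr>carrier := generate G S\<rparr>) Q. \<forall>b\<in>B. h b = f b"
  shows "finite B \<and> card B \<le> card S \<and> (card B = card S \<longrightarrow> free_mod G {\<one>} S)"
proof -
  let ?L = "generate G S"
  have sub: "subgroup ?L G" using S generate_is_subgroup by blast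
  have SL: "S \<subseteq> ?L" by (auto intro: generate.incl)
  \<comment> \<open>\<open>H f\<close> is the restriction to \<open>S\<close> of an extension of
    \<open>f\<close>; it determines that extension on <S> and hence \<open>f\<close>. Subsets
    \<open>A\<close> of \<open>B\<close> are allowed because \<open>B\<close> is not yet known to be
    finite; the values on the rest of \<open>B\<close> are set to the identity.\<close>
  have inj: "\<exists>H. inj_on H (A \<rightarrow>\<^sub>E carrier Q) \<and> H ` (A \<rightarrow>\<^sub>E carrier Q) \<subseteq> S \<rightarrow>\<^sub>E carrier Q \<and>
      (\<forall>f\<in>A \<rightarrow>\<^sub>E carrier Q. \<exists>h\<in>hom (G\<lparr>carrier := ?L\<rparr>) Q. restrict h S = H f)"
    if Q: "group Q" and A: "A \<subseteq> B" for Q :: "(nat \<Rightarrow> nat) monoid" and A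
  proof -
    interpret Q: group Q by fact
    have "\<exists>h. h \<in> hom (G\<lparr>carrier := ?L\<rparr>) Q \<and> (\<forall>a\<in>A. h a = f a)" if "f \<in> A \<rightarrow>\<^sub>E carrier Q" for f
    proof -
      have "(\<lambda>b. if b \<in> A then f b else \<one>\<^bsub>Q\<^esub>) \<in> B \<rightarrow> carrier Q" using that by auto
      from ext[OF Q this] obtain h where "h \<in> hom (G\<lparr>carrier := ?L\<rparr>) Q"
        "\<forall>b\<in>B. h b = (if b \<in> A then f b else \<one>\<^bsub>Q\<^esub>)" by blast
      then show ?thesis using A by (intro exI[of _ h]) auto
    qed
    then obtain h where h: "\<And>f. f \<in> A \<rightarrow>\<^sub>E carrier Q \<Longrightarrow> h f \<in> hom (G\<lparr>carrier := ?L\<rparr>) Q"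
      "\<And>f a. f \<in> A \<rightarrow>\<^sub>E carrier Q \<Longrightarrow> a \<in> A \<Longrightarrow> h f a = f a" by metis
    have "inj_on (\<lambda>f. restrict (h f) S) (A \<rightarrow>\<^sub>E carrier Q)"
    proof (rule inj_onI)
      fix f k assume fk: "f \<in> A \<rightarrow>\<^sub>E carrier Q" "k \<in> A \<rightarrow>\<^sub>E carrier Q"
        "restrict (h f) S = restrict (h k) S"
      then have "h f s = h k s" if "s \<in> S" for s using that by (metis restrict_apply')
      then have "h f x = h k x" if "x \<in> ?L" for x
        using hom_eq_on_generate[OF is_group Q sub h(1)[OF fk(1)] h(1)[OF fk(2)] SL _ that] by blast
      then have "f a = k a" if "a \<in> A" for a
        using that h(2)[OF fk(1) that] h(2)[OF fk(2) that] A B by fastforce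
      then show "f = k" using fk(1,2) by (meson PiE_ext)
    qed
    moreover have "(\<lambda>f. restrict (h f) S) ` (A \<rightarrow>\<^sub>E carrier Q) \<subseteq> S \<rightarrow>\<^sub>E carrier Q"
      using h(1) SL by (auto simp: hom_def PiE_def Pi_def)
    ultimately show ?thesis using h(1) by blast
  qed
  have le: "card A \<le> card S" if A: "A \<subseteq> B" "finite A" for A
  proof -
    \<comment> \<open>Any finite group with more than one element serves to compare the
      exponents.\<close>
    define Q where "Q = BijGroup {0, 1::nat}"
    have finQ: "finite (carrier Q)" by (simp add: Q_def carrier_BijGroup finite_Bij)
    obtain H where "inj_on H (A \<rightarrow>\<^sub>E carrier Q)" "H ` (A \<rightarrow>\<^sub>E carrier Q) \<subseteq> S \<rightarrow>\<^sub>E carrier Q"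
      using inj[of Q A] A group_BijGroup Q_def by blast
    then have "card (A \<rightarrow>\<^sub>E carrier Q) \<le> card (S \<rightarrow>\<^sub>E carrier Q)"
      using S finQ by (meson card_inj_on_le finite_PiE)
    then have "card (carrier Q) ^ card A \<le> card (carrier Q) ^ card S"
      using A S by (simp add: card_PiE)
    moreover have "1 < card (carrier Q)"
    proof -
      have "\<exists>p\<in>Bij {0,1::nat}. \<forall>x\<in>{0}. p x = 1" by (rule inj_on_extend_Bij) auto
      then obtain p where p: "p \<in> carrier Q" "p 0 = 1" by (auto simp: Q_def carrier_BijGroup)
      have one: "\<one>\<^bsub>Q\<^esub> \<in> carrier Q" unfolding Q_def using group_BijGroup group.is_monoid monoid.one_closed by blast
      have "p \<noteq> \<one>\<^bsub>Q\<^esub>" using p BijGroup_one_apply[of 0 "{0,1::nat}"] by (auto simp: Q_def)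
      then have "card {p, \<one>\<^bsub>Q\<^esub>} = 2" by simp
      moreover have "card {p, \<one>\<^bsub>Q\<^esub>} \<le> card (carrier Q)" using p one finQ by (intro card_mono) auto
      ultimately show ?thesis by simp
    qed
    ultimately show ?thesis by (meson power_le_imp_le_exp)
  qed
  then have fin: "finite B"
    using finite_if_finite_subsets_card_bdd by metis
  have "free_mod G {\<one>} S" if card: "card B = card S"
    unfolding free_mod_def
  proof (intro allI impI)
    fix ws assume ws: "ws \<noteq> [] \<and> fst ` set ws \<subseteq> S \<and> freely_reduced ws"
    define Q where "Q = BijGroup {..length ws}"
    obtain f where f: "\<And>x. f x \<in> carrier Q" "eval_gword Q (map (apfst f) ws) \<noteq> \<one>\<^bsub>Q\<^esub>"
      using freely_reduced_residually_finite[of ws] ws by (auto simp: Q_def carrier_BijGroup)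
    have Q: "group Q" by (simp add: Q_def group_BijGroup)
    have finQ: "finite (carrier Q)" by (simp add: Q_def carrier_BijGroup finite_Bij)
    obtain H where H: "inj_on H (B \<rightarrow>\<^sub>E carrier Q)" "H ` (B \<rightarrow>\<^sub>E carrier Q) \<subseteq> S \<rightarrow>\<^sub>E carrier Q"
      "\<forall>f\<in>B \<rightarrow>\<^sub>E carrier Q. \<exists>h\<in>hom (G\<lparr>carrier := ?L\<rparr>) Q. restrict h S = H f"
      using inj[OF Q order_refl] by blast
    have "card (H ` (B \<rightarrow>\<^sub>E carrier Q)) = card (S \<rightarrow>\<^sub>E carrier Q)"
      using H(1) S fin card by (simp add: card_image card_PiE)
    then have "H ` (B \<rightarrow>\<^sub>E carrier Q) = S \<rightarrow>\<^sub>E carrier Q"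
      using H(2) S finQ by (meson card_subset_eq finite_PiE)
    moreover have "restrict f S \<in> S \<rightarrow>\<^sub>E carrier Q" using f(1) by auto
    ultimately obtain h where h: "h \<in> hom (G\<lparr>carrier := ?L\<rparr>) Q" "restrict h S = restrict f S"
      using H(3) by (metis (no_types, lifting) imageE)
    interpret h: group_hom "G\<lparr>carrier := ?L\<rparr>" Q h
      using h(1) Q sub by (intro group_hom.intro group_hom_axioms.intro subgroup.subgroup_is_group is_group)
    have hs: "h s = f s" if "s \<in> S" for s using h(2) that by (metis restrict_apply')
    have "h (eval_gword G ws) = eval_gword Q (map (apfst h) ws)"
      using h.hom_eval_gword[of ws] eval_gword_subgroup[OF sub, of ws] ws SL by auto
    also have "map (apfst h) ws = map (apfst f) ws" using ws hs by (auto simp: apfst_def map_prod_def)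
    finally have "h (eval_gword G ws) \<noteq> h \<one>" using f(2) h.hom_one by simp
    then show "eval_gword G ws \<notin> {\<one>}" by auto
  qed
  with le[OF order_refl] fin show ?thesis by blast
qed

section \<open>Schreier graphs and bases of subgroups\<close>

definition gen_letters :: "(nat \<times> int) list set" where
  "gen_letters = range gen \<union> (\<lambda>n. inv\<^bsub>FZ\<^esub> (gen n)) ` UNIV"

lemma gen_letters_closed: "e \<in> gen_letters \<Longrightarrow> e \<in> carrier FZ"
  by (auto simp: gen_letters_def)

text \<open>Walks of length \<open>k\<close> from the vertex \<open>L\<close> in the Schreier graph,
  whose vertices are the left cosets and whose edges are left multiplications by generators and
  their inverses.\<close>

inductive coset_at :: "(nat \<times> int) list set \<Rightarrow> nat \<Rightarrow> (nat \<times> int) list set \<Rightarrow> bool" for L where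
  zero: "coset_at L 0 L"
| step: "coset_at L k C \<Longrightarrow> e \<in> gen_letters \<Longrightarrow> coset_at L (Suc k) (e <#\<^bsub>FZ\<^esub> C)"

definition cosets_of :: "(nat \<times> int) list set \<Rightarrow> (nat \<times> int) list set set" where
  "cosets_of L = (\<lambda>g. g <#\<^bsub>FZ\<^esub> L) ` carrier FZ"

context
  fixes L assumes L: "subgroup L FZ"
begin

lemma L_subset: "L \<subseteq> carrier FZ"
  using L subgroup.subset by blast

lemma coset_subset: "C \<in> cosets_of L \<Longrightarrow> C \<subseteq> carrier FZ"
  by (auto simp: cosets_of_def FZ.l_coset_subset_G[OF L_subset, THEN subsetD])

lemma act_act:
  "C \<in> cosets_of L \<Longrightarrow> g \<in> carrier FZ \<Longrightarrow> h \<in> carrier FZ \<Longrightarrow>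
     g <#\<^bsub>FZ\<^esub> (h <#\<^bsub>FZ\<^esub> C) = (g \<otimes>\<^bsub>FZ\<^esub> h) <#\<^bsub>FZ\<^esub> C"
  using FZ.lcos_m_assoc[OF coset_subset] by blast

lemma act_one: "C \<in> cosets_of L \<Longrightarrow> \<one>\<^bsub>FZ\<^esub> <#\<^bsub>FZ\<^esub> C = C"
  using FZ.lcos_mult_one[OF coset_subset] by blast

lemma L_in_cosets: "L \<in> cosets_of L"
  unfolding cosets_of_def using FZ.lcos_mult_one[OF L_subset] by (intro image_eqI[of _ _ "\<one>\<^bsub>FZ\<^esub>"]) auto

lemma act_closed: "C \<in> cosets_of L \<Longrightarrow> g \<in> carrier FZ \<Longrightarrow> g <#\<^bsub>FZ\<^esub> C \<in> cosets_of L"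
  using FZ.lcos_m_assoc[OF L_subset, of g] by (auto simp: cosets_of_def)

lemma act_inv:
  assumes "C \<in> cosets_of L" "g \<in> carrier FZ"
  shows "inv\<^bsub>FZ\<^esub> g <#\<^bsub>FZ\<^esub> (g <#\<^bsub>FZ\<^esub> C) = C" "g <#\<^bsub>FZ\<^esub> (inv\<^bsub>FZ\<^esub> g <#\<^bsub>FZ\<^esub> C) = C"
  using assms by (simp_all add: act_act act_one)

lemma act_L: "l \<in> L \<Longrightarrow> l <#\<^bsub>FZ\<^esub> L = L"
  using FZ.coset_join3[OF _ L] L_subset by blast

lemma act_L_imp: "g \<in> carrier FZ \<Longrightarrow> g <#\<^bsub>FZ\<^esub> L = L \<Longrightarrow> g \<in> L"
  using FZ.lcos_self[OF _ L] by blast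

text \<open>Connectedness of the Schreier graph. The induction over the acting element treats all
  reachable cosets at once, since in a product the left factor acts on the coset already moved by
  the right one.\<close>

lemma ex_coset_at:
  assumes "C \<in> cosets_of L" shows "\<exists>k. coset_at L k C"
proof -
  have step: "\<exists>k. coset_at L k (e <#\<^bsub>FZ\<^esub> C)" if "e \<in> gen_letters" "\<exists>k. coset_at L k C" for e C
    using coset_at.step that by blast
  have "\<forall>C\<in>cosets_of L. (\<exists>k. coset_at L k C) \<longrightarrow> (\<exists>k. coset_at L k (g <#\<^bsub>FZ\<^esub> C))"
    if "g \<in> generate FZ (range gen)" for g
    using that
  proof induction
    case one then show ?case using act_one by auto
  next
    case (incl h)
    then have "h \<in> gen_letters" by (auto simp: gen_letters_def)
    with step show ?case by blast
  next
    case (inv h)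
    then have "inv\<^bsub>FZ\<^esub> h \<in> gen_letters" by (auto simp: gen_letters_def)
    with step show ?case by blast
  next
    case (eng g h)
    have c: "g \<in> carrier FZ" "h \<in> carrier FZ" using eng(1,2) by (simp_all add: generate_gen)
    show ?case
    proof (intro ballI impI)
      fix C assume C: "C \<in> cosets_of L" "\<exists>k. coset_at L k C"
      then have "\<exists>k. coset_at L k (g <#\<^bsub>FZ\<^esub> (h <#\<^bsub>FZ\<^esub> C))"
        using eng(3,4) act_closed[OF C(1) c(2)] by blast
      then show "\<exists>k. coset_at L k ((g \<otimes>\<^bsub>FZ\<^esub> h) <#\<^bsub>FZ\<^esub> C)" using c C by (simp add: act_act)
    qed
  qed
  moreover obtain g where "g \<in> carrier FZ" "C = g <#\<^bsub>FZ\<^esub> L"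
    using assms by (auto simp: cosets_of_def)
  ultimately show ?thesis
    using L_in_cosets coset_at.zero unfolding generate_gen by blast
qed

text \<open>A breadth-first spanning tree: \<open>lev\<close> is the distance from \<open>L\<close>,
  and \<open>t C\<close> is the product of the letters along the tree path to \<open>C\<close>.
  Well-founded choice along \<open>lev\<close> makes the representatives of a coset and of its
  parent differ by exactly one letter.\<close>

lemma ex_schreier_transversal:
  obtains t lev where "t L = \<one>\<^bsub>FZ\<^esub>"
    "\<And>C. C \<in> cosets_of L \<Longrightarrow> t C \<in> carrier FZ \<and> t C <#\<^bsub>FZ\<^esub> L = C"
    "\<And>C. C \<in> cosets_of L \<Longrightarrow> C \<noteq> L \<Longrightarrow>
       \<exists>e\<in>gen_letters. \<exists>D\<in>cosets_of L. lev D < (lev C :: nat) \<and> C = e <#\<^bsub>FZ\<^esub> D \<and> t C = e \<otimes>\<^bsub>FZ\<^esub> t D"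
proof -
  define lev where "lev = (\<lambda>C. LEAST k. coset_at L k C)"
  define P where "P = (\<lambda>f C r. C \<in> cosets_of L \<longrightarrow>
     (if C = L then r = \<one>\<^bsub>FZ\<^esub> else \<exists>e\<in>gen_letters. \<exists>D\<in>cosets_of L. lev D < lev C \<and> C = e <#\<^bsub>FZ\<^esub> D \<and> r = e \<otimes>\<^bsub>FZ\<^esub> f D))"
  have "\<exists>t. \<forall>C. P t C (t C)"
  proof (rule dependent_wf_choice[of "measure lev" P])
    show "wf (measure lev)" by simp
    show "P f C r = P g C r" if "\<And>z. (z, C) \<in> measure lev \<Longrightarrow> f z = g z" for f g C r
      using that unfolding P_def by auto metis+
    show "\<exists>r. P f C r" for C f
    proof (cases "C \<in> cosets_of L \<and> C \<noteq> L")
      case True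
      have at: "coset_at L (lev C) C"
        using ex_coset_at True unfolding lev_def by (meson LeastI_ex)
      then obtain k D e where *: "lev C = Suc k" "coset_at L k D" "e \<in> gen_letters" "C = e <#\<^bsub>FZ\<^esub> D"
        using True by (cases rule: coset_at.cases) auto
      have "lev D \<le> k" unfolding lev_def using *(2) by (rule Least_le)
      moreover have "D \<in> cosets_of L" using *(2)
        by induction (auto simp: L_in_cosets act_closed gen_letters_closed)
      ultimately show ?thesis using * True unfolding P_def by (metis le_imp_less_Suc)
    qed (auto simp: P_def)
  qed
  then obtain t where t: "\<And>C. P t C (t C)" by blast
  have 1: "t L = \<one>\<^bsub>FZ\<^esub>" using t[of L] L_in_cosets by (simp add: P_def)
  have 3: "\<exists>e\<in>gen_letters. \<exists>D\<in>cosets_of L. lev D < lev C \<and> C = e <#\<^bsub>FZ\<^esub> D \<and> t C = e \<otimes>\<^bsub>FZ\<^esub> t D"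
    if "C \<in> cosets_of L" "C \<noteq> L" for C
    using t[of C] that by (simp add: P_def)
  have 2: "t C \<in> carrier FZ \<and> t C <#\<^bsub>FZ\<^esub> L = C" if "C \<in> cosets_of L" for C
    using that
  proof (induction "lev C" arbitrary: C rule: less_induct)
    case less
    show ?case
    proof (cases "C = L")
      case True then show ?thesis using 1 act_one L_in_cosets by simp
    next
      case False
      then obtain e D where *: "e \<in> gen_letters" "D \<in> cosets_of L" "lev D < lev C" "C = e <#\<^bsub>FZ\<^esub> D"
        "t C = e \<otimes>\<^bsub>FZ\<^esub> t D" using 3 less.prems by blast
      with less.hyps[of D] show ?thesis
        using gen_letters_closed act_act[OF L_in_cosets, of e "t D"] by simp
    qed
  qed
  from that[of t lev] 1 2 3 show thesis by blast
qed

text \<open>A Schreier transversal \<open>t\<close> of \<open>F / L\<close> gives the generators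
  \<open>t (x C)\<inverse> x (t C)\<close> of \<open>L\<close>.  To extend \<open>f\<close> from them to a homomorphism into \<open>Q\<close>, let \<open>F\<close> act on
  \<open>Q \<times> F / L\<close> by \<open>x (q, C) = (f (t (x C)\<inverse> x (t C)) q, x C)\<close> and
  read off the first component of the orbit of \<open>(1, L)\<close> under \<open>L\<close>.\<close>

lemma ex_extension_basis:
  obtains B where "B \<subseteq> L" "generate FZ B = L"
    "\<And>(Q :: 'q monoid) f. group Q \<Longrightarrow> f \<in> B \<rightarrow> carrier Q \<Longrightarrow>
       \<exists>h\<in>hom (FZ\<lparr>carrier := L\<rparr>) Q. \<forall>b\<in>B. h b = f b"
proof -
  obtain t and lev :: "_ \<Rightarrow> nat" where t1: "t L = \<one>\<^bsub>FZ\<^esub>"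
    and t2: "\<And>C. C \<in> cosets_of L \<Longrightarrow> t C \<in> carrier FZ \<and> t C <#\<^bsub>FZ\<^esub> L = C"
    and t3: "\<And>C. C \<in> cosets_of L \<Longrightarrow> C \<noteq> L \<Longrightarrow>
       \<exists>e\<in>gen_letters. \<exists>D\<in>cosets_of L. lev D < lev C \<and> C = e <#\<^bsub>FZ\<^esub> D \<and> t C = e \<otimes>\<^bsub>FZ\<^esub> t D"
    using ex_schreier_transversal by metis
  have tc [simp]: "C \<in> cosets_of L \<Longrightarrow> t C \<in> carrier FZ" for C using t2 by blast
  \<comment> \<open>The Schreier cocycle, measuring how \<open>g\<close> fails to carry the
    representative of a coset to the representative of its image. By \<open>b_mult\<close> it
    reduces to the values on generators, and \<open>b l L = l\<close> for \<open>l\<close> in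
    \<open>L\<close>.\<close>
  define b where "b = (\<lambda>g C. inv\<^bsub>FZ\<^esub> (t (g <#\<^bsub>FZ\<^esub> C)) \<otimes>\<^bsub>FZ\<^esub> (g \<otimes>\<^bsub>FZ\<^esub> t C))"
  have bc [simp]: "b g C \<in> carrier FZ" if "g \<in> carrier FZ" "C \<in> cosets_of L" for g C
    using that by (simp add: b_def act_closed)
  have b_mult: "b (g \<otimes>\<^bsub>FZ\<^esub> h) C = b g (h <#\<^bsub>FZ\<^esub> C) \<otimes>\<^bsub>FZ\<^esub> b h C"
    if "g \<in> carrier FZ" "h \<in> carrier FZ" "C \<in> cosets_of L" for g h C
  proof -
    let ?D = "h <#\<^bsub>FZ\<^esub> C"
    have D: "?D \<in> cosets_of L" using that by (simp add: act_closed)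
    have "t ?D \<otimes>\<^bsub>FZ\<^esub> (inv\<^bsub>FZ\<^esub> (t ?D) \<otimes>\<^bsub>FZ\<^esub> (h \<otimes>\<^bsub>FZ\<^esub> t C)) = h \<otimes>\<^bsub>FZ\<^esub> t C"
      using that D by (simp add: FZ.m_assoc[symmetric])
    then show ?thesis using that D by (simp add: b_def FZ.m_assoc act_act act_closed)
  qed
  have b_one: "b \<one>\<^bsub>FZ\<^esub> C = \<one>\<^bsub>FZ\<^esub>" if "C \<in> cosets_of L" for C
    using that by (simp add: b_def act_one)
  have b_inv: "b (inv\<^bsub>FZ\<^esub> g) C = inv\<^bsub>FZ\<^esub> (b g (inv\<^bsub>FZ\<^esub> g <#\<^bsub>FZ\<^esub> C))"
    if "g \<in> carrier FZ" "C \<in> cosets_of L" for g C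
  proof -
    have "b g (inv\<^bsub>FZ\<^esub> g <#\<^bsub>FZ\<^esub> C) \<otimes>\<^bsub>FZ\<^esub> b (inv\<^bsub>FZ\<^esub> g) C = \<one>\<^bsub>FZ\<^esub>"
      using b_mult[of g "inv\<^bsub>FZ\<^esub> g" C] that by (simp add: b_one)
    then have "inv\<^bsub>FZ\<^esub> (b (inv\<^bsub>FZ\<^esub> g) C) = b g (inv\<^bsub>FZ\<^esub> g <#\<^bsub>FZ\<^esub> C)"
      using that by (intro FZ.inv_equality) (simp_all add: act_closed)
    then show ?thesis using that FZ.inv_inv[of "b (inv\<^bsub>FZ\<^esub> g) C"] by simp
  qed
  \<comment> \<open>Edges of the tree contribute the identity, which must be discarded: no
    homomorphism could send it to an arbitrary value of \<open>f\<close>.\<close>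
  define B where "B = {b (gen n) C | n C. C \<in> cosets_of L} - {\<one>\<^bsub>FZ\<^esub>}"
  have BL: "B \<subseteq> L"
  proof -
    have "b (gen n) C \<in> L" if C: "C \<in> cosets_of L" for n C
    proof (rule act_L_imp)
      have "b (gen n) C <#\<^bsub>FZ\<^esub> L = inv\<^bsub>FZ\<^esub> (t (gen n <#\<^bsub>FZ\<^esub> C)) <#\<^bsub>FZ\<^esub> (gen n <#\<^bsub>FZ\<^esub> (t C <#\<^bsub>FZ\<^esub> L))"
        using C L_in_cosets by (simp add: b_def act_act act_closed)
      also have "\<dots> = inv\<^bsub>FZ\<^esub> (t (gen n <#\<^bsub>FZ\<^esub> C)) <#\<^bsub>FZ\<^esub> (t (gen n <#\<^bsub>FZ\<^esub> C) <#\<^bsub>FZ\<^esub> L)"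
        using t2[OF C] t2[of "gen n <#\<^bsub>FZ\<^esub> C"] C by (simp add: act_closed)
      also have "\<dots> = L" using C L_in_cosets by (simp add: act_inv act_closed)
      finally show "b (gen n) C <#\<^bsub>FZ\<^esub> L = L" .
    qed (use C in simp)
    then show ?thesis by (auto simp: B_def)
  qed
  have Bc: "B \<subseteq> carrier FZ" using BL L_subset by blast
  have bB: "b (gen n) C \<in> generate FZ B" if "C \<in> cosets_of L" for n C
    using that by (cases "b (gen n) C = \<one>\<^bsub>FZ\<^esub>") (auto simp: B_def intro: generate.intros)
  have b_gen: "\<forall>C\<in>cosets_of L. b g C \<in> generate FZ B" if "g \<in> generate FZ (range gen)" for g
    using that
  proof induction
    case one then show ?case by (simp add: b_one generate.one)
  next
    case (incl h) then show ?case using bB by auto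
  next
    case (inv h) then show ?case
      using bB b_inv FZ.generate_m_inv_closed[OF Bc] by (auto simp: act_closed)
  next
    case (eng g h)
    have "g \<in> carrier FZ" "h \<in> carrier FZ" using eng(1,2) by (simp_all add: generate_gen)
    then show ?case using eng b_mult by (auto simp: act_closed intro: generate.eng)
  qed
  have genB: "generate FZ B = L"
  proof
    show "generate FZ B \<subseteq> L" by (rule FZ.generate_subgroup_incl[OF BL L])
    show "L \<subseteq> generate FZ B"
    proof
      fix l assume l: "l \<in> L"
      then have "b l L \<in> generate FZ B" using b_gen L_in_cosets L_subset generate_gen by blast
      moreover have "b l L = l" using l L_subset by (auto simp: b_def act_L t1)
      ultimately show "l \<in> generate FZ B" by simp
    qed
  qed
  have ext: "\<exists>h\<in>hom (FZ\<lparr>carrier := L\<rparr>) Q. \<forall>b\<in>B. h b = f b"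
    if Q: "group Q" and f: "f \<in> B \<rightarrow> carrier Q" for Q :: "'q monoid" and f
  proof -
    interpret Q: group Q by fact
    define S where "S = carrier Q \<times> cosets_of L"
    \<comment> \<open>The value on tree edges, which were dropped from \<open>B\<close>, has to be
      the identity of \<open>Q\<close>.\<close>
    define f' where "f' = (\<lambda>y. if y = \<one>\<^bsub>FZ\<^esub> then \<one>\<^bsub>Q\<^esub> else f y)"
    have f'c [simp]: "f' (b (gen n) C) \<in> carrier Q" if "C \<in> cosets_of L" for n C
      using f that by (auto simp: f'_def B_def)
    define p where "p = (\<lambda>n. \<lambda>(q, C)\<in>S. (f' (b (gen n) C) \<otimes>\<^bsub>Q\<^esub> q, gen n <#\<^bsub>FZ\<^esub> C))"
    have p_apply: "p n (q, C) = (f' (b (gen n) C) \<otimes>\<^bsub>Q\<^esub> q, gen n <#\<^bsub>FZ\<^esub> C)"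
      if "q \<in> carrier Q" "C \<in> cosets_of L" for n q C
      using that by (simp add: p_def S_def)
    have pBij: "p n \<in> Bij S" for n
    proof -
      let ?r = "\<lambda>(q, C). (inv\<^bsub>Q\<^esub> (f' (b (gen n) (inv\<^bsub>FZ\<^esub> (gen n) <#\<^bsub>FZ\<^esub> C))) \<otimes>\<^bsub>Q\<^esub> q, inv\<^bsub>FZ\<^esub> (gen n) <#\<^bsub>FZ\<^esub> C)"
      have "bij_betw (p n) S S"
        by (rule bij_betw_byWitness[where f' = ?r])
           (auto simp: S_def p_apply act_closed act_inv Q.m_assoc[symmetric])
      then show ?thesis by (simp add: Bij_def p_def)
    qed
    let ?P = "BijGroup S"
    interpret P: group ?P by (rule group_BijGroup)
    define \<Phi> where "\<Phi> = eval ?P p"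
    have pc: "p n \<in> carrier ?P" for n using pBij by (simp add: carrier_BijGroup)
    interpret \<Phi>: group_hom FZ ?P \<Phi>
      unfolding \<Phi>_def using P.eval_hom[of p, OF pc] by (intro group_hom.intro group_hom_axioms.intro group_FZ P.is_group)
    have \<Phi>gen: "\<Phi> (gen n) = p n" for n
      unfolding \<Phi>_def using P.eval_gen[of p, OF pc] by blast
    note \<Phi>.hom_one [simp del] \<Phi>.hom_mult [simp del] \<Phi>.hom_inv [simp del]
    have \<Phi>Bij: "g \<in> carrier FZ \<Longrightarrow> \<Phi> g \<in> Bij S" for g
      using \<Phi>.hom_closed by (simp add: carrier_BijGroup)
    have \<Phi>mult: "\<Phi> (g \<otimes>\<^bsub>FZ\<^esub> h) x = \<Phi> g (\<Phi> h x)" if "g \<in> carrier FZ" "h \<in> carrier FZ" "x \<in> S" for g h x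
      using that by (simp add: \<Phi>.hom_mult BijGroup_mult_apply \<Phi>Bij)
    have \<Phi>inv: "\<Phi> (inv\<^bsub>FZ\<^esub> g) y = x" if "g \<in> carrier FZ" "x \<in> S" "\<Phi> g x = y" for g x y
      using that BijGroup_inv_apply[OF \<Phi>Bij] by (simp add: \<Phi>.hom_inv)
    have \<Phi>one: "\<Phi> \<one>\<^bsub>FZ\<^esub> x = x" if "x \<in> S" for x
      using that by (simp add: \<Phi>.hom_one BijGroup_one_apply)
    \<comment> \<open>Every \<open>g\<close> acts on the first coordinate over a fixed coset by a
      left translation. Carrying an arbitrary left factor \<open>q\<close> closes the statement
      under composition: the \<open>r\<close> produced by one element is the \<open>q\<close> fed to
      the next.\<close>
    have equi: "\<forall>C\<in>cosets_of L. \<forall>q\<in>carrier Q. \<exists>r\<in>carrier Q. \<forall>q'\<in>carrier Q.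
        \<Phi> g (q \<otimes>\<^bsub>Q\<^esub> q', C) = (r \<otimes>\<^bsub>Q\<^esub> q', g <#\<^bsub>FZ\<^esub> C)"
      if "g \<in> generate FZ (range gen)" for g
      using that
    proof induction
      case one
      then show ?case by (auto simp: \<Phi>one S_def act_one)
    next
      case (incl h)
      then obtain n where n: "h = gen n" by auto
      show ?case
      proof (intro ballI)
        fix C q assume "C \<in> cosets_of L" "q \<in> carrier Q"
        then show "\<exists>r\<in>carrier Q. \<forall>q'\<in>carrier Q. \<Phi> h (q \<otimes>\<^bsub>Q\<^esub> q', C) = (r \<otimes>\<^bsub>Q\<^esub> q', h <#\<^bsub>FZ\<^esub> C)"
          by (intro bexI[of _ "f' (b h C) \<otimes>\<^bsub>Q\<^esub> q"]) (auto simp: n \<Phi>gen p_apply Q.m_assoc)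
      qed
    next
      case (inv h)
      then obtain n where n: "h = gen n" by auto
      show ?case
      proof (intro ballI)
        fix C q assume C: "C \<in> cosets_of L" "q \<in> carrier Q"
        let ?D = "inv\<^bsub>FZ\<^esub> h <#\<^bsub>FZ\<^esub> C"
        let ?r = "inv\<^bsub>Q\<^esub> (f' (b h ?D)) \<otimes>\<^bsub>Q\<^esub> q"
        have D: "?D \<in> cosets_of L" using C n by (simp add: act_closed)
        have "\<Phi> (inv\<^bsub>FZ\<^esub> h) (q \<otimes>\<^bsub>Q\<^esub> q', C) = (?r \<otimes>\<^bsub>Q\<^esub> q', ?D)" if "q' \<in> carrier Q" for q'
          using that C D by (intro \<Phi>inv) (auto simp: n \<Phi>gen p_apply S_def act_inv Q.m_assoc[symmetric])
        then show "\<exists>r\<in>carrier Q. \<forall>q'\<in>carrier Q. \<Phi> (inv\<^bsub>FZ\<^esub> h) (q \<otimes>\<^bsub>Q\<^esub> q', C) = (r \<otimes>\<^bsub>Q\<^esub> q', ?D)"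
          using C D n by (intro bexI[of _ ?r]) auto
      qed
    next
      case (eng g h)
      have c: "g \<in> carrier FZ" "h \<in> carrier FZ" using eng(1,2) by (simp_all add: generate_gen)
      show ?case
      proof (intro ballI)
        fix C q assume C: "C \<in> cosets_of L" "q \<in> carrier Q"
        obtain r where r: "r \<in> carrier Q" "\<forall>q'\<in>carrier Q. \<Phi> h (q \<otimes>\<^bsub>Q\<^esub> q', C) = (r \<otimes>\<^bsub>Q\<^esub> q', h <#\<^bsub>FZ\<^esub> C)"
          using eng(4) C by blast
        have D: "h <#\<^bsub>FZ\<^esub> C \<in> cosets_of L" using C c by (simp add: act_closed)
        obtain s where s: "s \<in> carrier Q" "\<forall>q'\<in>carrier Q. \<Phi> g (r \<otimes>\<^bsub>Q\<^esub> q', h <#\<^bsub>FZ\<^esub> C) = (s \<otimes>\<^bsub>Q\<^esub> q', g <#\<^bsub>FZ\<^esub> (h <#\<^bsub>FZ\<^esub> C))"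
          using eng(3) D r(1) by blast
        show "\<exists>r\<in>carrier Q. \<forall>q'\<in>carrier Q. \<Phi> (g \<otimes>\<^bsub>FZ\<^esub> h) (q \<otimes>\<^bsub>Q\<^esub> q', C) = (r \<otimes>\<^bsub>Q\<^esub> q', (g \<otimes>\<^bsub>FZ\<^esub> h) <#\<^bsub>FZ\<^esub> C)"
          using s r C c by (intro bexI[of _ s]) (auto simp: \<Phi>mult S_def act_act)
      qed
    qed
    have equi1: "\<exists>r\<in>carrier Q. \<forall>q\<in>carrier Q. \<Phi> g (q, C) = (r \<otimes>\<^bsub>Q\<^esub> q, g <#\<^bsub>FZ\<^esub> C)"
      if g: "g \<in> carrier FZ" and C: "C \<in> cosets_of L" for g C
      using equi[of g] g C Q.one_closed unfolding generate_gen by fastforce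
    \<comment> \<open>Along the tree no letter changes the first coordinate.\<close>
    have base: "\<Phi> (t C) (\<one>\<^bsub>Q\<^esub>, L) = (\<one>\<^bsub>Q\<^esub>, C)" if "C \<in> cosets_of L" for C
      using that
    proof (induction "lev C" arbitrary: C rule: less_induct)
      case less
      show ?case
      proof (cases "C = L")
        case True then show ?thesis using L_in_cosets by (simp add: t1 \<Phi>one S_def)
      next
        case False
        then obtain e D where *: "e \<in> gen_letters" "D \<in> cosets_of L" "lev D < lev C" "C = e <#\<^bsub>FZ\<^esub> D"
          "t C = e \<otimes>\<^bsub>FZ\<^esub> t D" using t3 less.prems by blast
        have IH: "\<Phi> (t D) (\<one>\<^bsub>Q\<^esub>, L) = (\<one>\<^bsub>Q\<^esub>, D)" using less.hyps * by blast
        have "\<Phi> e (\<one>\<^bsub>Q\<^esub>, D) = (\<one>\<^bsub>Q\<^esub>, C)"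
        proof -
          consider n where "e = gen n" | n where "e = inv\<^bsub>FZ\<^esub> (gen n)"
            using *(1) by (auto simp: gen_letters_def)
          then show ?thesis
          proof cases
            case 1
            have "b e D = \<one>\<^bsub>FZ\<^esub>" using * 1 less.prems by (simp add: b_def flip: *(4,5))
            then show ?thesis using * 1 by (simp add: \<Phi>gen p_apply f'_def)
          next
            case 2
            \<comment> \<open>An edge traversed backwards is the \<open>gen n\<close>-edge from
              \<open>C\<close> to its parent \<open>D\<close>, so the trivial Schreier generator is
              the one based at \<open>C\<close>.\<close>
            have tD: "gen n \<otimes>\<^bsub>FZ\<^esub> t C = t D" "gen n <#\<^bsub>FZ\<^esub> C = D"
              using * 2 by (simp_all add: FZ.m_assoc[symmetric] act_inv)
            then have "b (gen n) C = \<one>\<^bsub>FZ\<^esub>" using * by (simp add: b_def)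
            then have "\<Phi> (gen n) (\<one>\<^bsub>Q\<^esub>, C) = (\<one>\<^bsub>Q\<^esub>, D)"
              using less.prems tD by (simp add: \<Phi>gen p_apply f'_def)
            then show ?thesis unfolding 2 using less.prems by (intro \<Phi>inv) (auto simp: S_def)
          qed
        qed
        then show ?thesis using * IH gen_letters_closed L_in_cosets by (simp add: \<Phi>mult S_def)
      qed
    qed
    define c where "c = (\<lambda>g. fst (\<Phi> g (\<one>\<^bsub>Q\<^esub>, L)))"
    have c: "c l \<in> carrier Q \<and> (\<forall>q\<in>carrier Q. \<Phi> l (q, L) = (c l \<otimes>\<^bsub>Q\<^esub> q, L))" if l: "l \<in> L" for l
      using equi1[of l L] l L_subset L_in_cosets act_L[OF l] by (fastforce simp: c_def)
    have "c \<in> hom (FZ\<lparr>carrier := L\<rparr>) Q"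
    proof (rule homI)
      fix k l assume "k \<in> carrier (FZ\<lparr>carrier := L\<rparr>)" "l \<in> carrier (FZ\<lparr>carrier := L\<rparr>)"
      then have kl: "k \<in> L" "l \<in> L" by auto
      then have "\<Phi> (k \<otimes>\<^bsub>FZ\<^esub> l) (\<one>\<^bsub>Q\<^esub>, L) = \<Phi> k (\<Phi> l (\<one>\<^bsub>Q\<^esub>, L))"
        using L_subset L_in_cosets by (intro \<Phi>mult) (auto simp: S_def)
      also have "\<dots> = (c k \<otimes>\<^bsub>Q\<^esub> c l, L)" using c[OF kl(1)] c[OF kl(2)] by simp
      finally show "c (k \<otimes>\<^bsub>FZ\<lparr>carrier := L\<rparr>\<^esub> l) = c k \<otimes>\<^bsub>Q\<^esub> c l" by (simp add: c_def)
    qed (use c in auto)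
    moreover have "c y = f y" if y: "y \<in> B" for y
    proof -
      obtain n C where nC: "y = b (gen n) C" "C \<in> cosets_of L" "y \<noteq> \<one>\<^bsub>FZ\<^esub>"
        using y by (auto simp: B_def)
      let ?D = "gen n <#\<^bsub>FZ\<^esub> C"
      have D: "?D \<in> cosets_of L" using nC by (simp add: act_closed)
      have fy: "f y \<in> carrier Q" using f y by auto
      have inv: "\<Phi> (inv\<^bsub>FZ\<^esub> (t ?D)) (\<one>\<^bsub>Q\<^esub>, ?D) = (\<one>\<^bsub>Q\<^esub>, L)"
        using D L_in_cosets by (intro \<Phi>inv base) (auto simp: S_def)
      obtain r where r: "r \<in> carrier Q" "\<forall>q\<in>carrier Q. \<Phi> (inv\<^bsub>FZ\<^esub> (t ?D)) (q, ?D) = (r \<otimes>\<^bsub>Q\<^esub> q, inv\<^bsub>FZ\<^esub> (t ?D) <#\<^bsub>FZ\<^esub> ?D)"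
        using equi1[of "inv\<^bsub>FZ\<^esub> (t ?D)" ?D] D by auto
      \<comment> \<open>The element \<open>y\<close> is the loop that follows the tree to
        \<open>C\<close>, crosses one edge and returns along the tree. Only that edge contributes,
        and its contribution is \<open>f y\<close>.\<close>
      have "\<Phi> (gen n \<otimes>\<^bsub>FZ\<^esub> t C) (\<one>\<^bsub>Q\<^esub>, L) = (f y, ?D)"
        using nC L_in_cosets fy by (simp add: \<Phi>mult S_def base \<Phi>gen p_apply f'_def)
      then have "\<Phi> y (\<one>\<^bsub>Q\<^esub>, L) = \<Phi> (inv\<^bsub>FZ\<^esub> (t ?D)) (f y, ?D)"
        unfolding nC(1) b_def using nC(2) D L_in_cosets by (simp add: \<Phi>mult S_def)
      also have "\<dots> = (f y, L)" using r inv fy by simp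
      finally show ?thesis by (simp add: c_def)
    qed
    ultimately show ?thesis by blast
  qed
  from that[OF BL genB ext] show thesis by blast
qed

end

text \<open>The Schreier basis of <S> is either strictly smaller than \<open>S\<close>, and then is
  the required generating set, or of the same size, and then \<open>S\<close> is free.\<close>

lemma nielsen_FZ: "nielsen FZ {\<one>\<^bsub>FZ\<^esub>}"
  unfolding nielsen_def
proof (intro allI impI)
  fix S assume S: "finite S \<and> S \<subseteq> carrier FZ"
  have sub: "subgroup (generate FZ S) FZ" using S FZ.generate_is_subgroup by blast
  obtain B where B: "B \<subseteq> generate FZ S" "generate FZ B = generate FZ S"
    "\<And>(Q :: (nat \<Rightarrow> nat) monoid) f. group Q \<Longrightarrow> f \<in> B \<rightarrow> carrier Q \<Longrightarrow>
       \<exists>h\<in>hom (FZ\<lparr>carrier := generate FZ S\<rparr>) Q. \<forall>b\<in>B. h b = f b"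
    using ex_extension_basis[OF sub] by blast
  have "finite B \<and> card B \<le> card S \<and> (card B = card S \<longrightarrow> free_mod FZ {\<one>\<^bsub>FZ\<^esub>} S)"
    using FZ.extension_basis_card[OF _ _ B(1) B(3)] S by blast
  moreover have "B \<subseteq> carrier FZ" using B(1) FZ.generate_incl S by blast
  ultimately show "free_mod FZ {\<one>\<^bsub>FZ\<^esub>} S \<or> (\<exists>T. finite T \<and> T \<subseteq> carrier FZ \<and> card T < card S \<and>
      generate FZ (T \<union> {\<one>\<^bsub>FZ\<^esub>}) = generate FZ (S \<union> {\<one>\<^bsub>FZ\<^esub>}))"
    using B(2) FZ.generate_Un_one S by (metis le_neq_implies_less)
qed

section \<open>Infinite words\<close>

text \<open>Allowing any index set \<open>I\<close>, rather than the initial segments used in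
  \<open>proj\<close>, makes room for the windows \<open>{n..m}\<close>.\<close>

definition supp :: "nat set \<Rightarrow> 'g word \<Rightarrow> rat set" where
  "supp I w = {q. \<exists>n g. w q = Some (n, g) \<and> n \<in> I}"

definition letters :: "nat set \<Rightarrow> 'g word \<Rightarrow> (nat \<times> 'g) list" where
  "letters I w = map (\<lambda>q. the (w q)) (sorted_list_of_set (supp I w))"

lemma proj_eq: "proj G m w = reduce G (letters {..m} w)"
  by (simp add: proj_def letters_def supp_def)

lemma words_ZZ_iff:
  "w \<in> words ZZ \<longleftrightarrow> (\<forall>q n g. w q = Some (n, g) \<longrightarrow> g \<noteq> 0) \<and> (\<forall>n. finite (supp {n} w))"
  by (auto simp: words_def is_word_def supp_def)

lemma supp_UN: "supp I w = (\<Union>n\<in>I. supp {n} w)"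
  by (auto simp: supp_def)

lemma supp_Int: "supp (I \<inter> J) w \<subseteq> supp I w"
  by (auto simp: supp_def)

lemma finite_supp: "w \<in> words ZZ \<Longrightarrow> finite I \<Longrightarrow> finite (supp I w)"
  by (subst supp_UN) (simp add: words_ZZ_iff)

lemma nonzero_letters_letters:
  assumes "w \<in> words ZZ" "finite I" shows "nonzero_letters (letters I w)"
  using assms finite_supp[OF assms]
  by (fastforce simp: nonzero_letters_def letters_def words_ZZ_iff supp_def)

lemma filter_sorted_list_of_set:
  "finite A \<Longrightarrow> filter P (sorted_list_of_set A) = sorted_list_of_set {x\<in>A. P x}"
  by (rule sorted_distinct_set_unique) (auto simp: sorted_wrt_filter)

lemma map_sorted_list_of_set:
  assumes "finite A" "strict_mono_on A f"
  shows "sorted_list_of_set (f ` A) = map f (sorted_list_of_set A)"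
proof (rule sorted_distinct_set_unique)
  have "sorted (map f xs)" if "sorted xs" "set xs \<subseteq> A" for xs
    using that assms(2)
    by (induction xs) (auto simp: strict_mono_on_def le_less)
  then show "sorted (map f (sorted_list_of_set A))" using assms(1) by simp
  show "distinct (map f (sorted_list_of_set A))"
    using assms strict_mono_on_imp_inj_on by (auto simp: distinct_map)
qed (use assms in auto)

lemma sorted_list_of_set_Un:
  assumes "finite A" "finite B" "\<And>a b. a \<in> A \<Longrightarrow> b \<in> B \<Longrightarrow> a < b"
  shows "sorted_list_of_set (A \<union> B) = sorted_list_of_set A @ sorted_list_of_set B"
  by (rule sorted_distinct_set_unique) (use assms in \<open>force simp: sorted_append\<close>)+

lemma filter_letters:
  assumes "finite (supp I w)"
  shows "filter (\<lambda>a. fst a \<in> J) (letters I w) = letters (I \<inter> J) w"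
proof -
  have "{q \<in> supp I w. fst (the (w q)) \<in> J} = supp (I \<inter> J) w"
    by (auto simp: supp_def)
  then show ?thesis
    using assms by (simp add: letters_def filter_map filter_sorted_list_of_set comp_def)
qed

lemma restr_proj:
  assumes "w \<in> words ZZ"
  shows "restr I (proj ZZ m w) = reduce ZZ (letters ({..m} \<inter> I) w)"
  using assms by (simp add: proj_eq restr_filter nonzero_letters_letters filter_letters finite_supp)

definition restrict_word :: "nat set \<Rightarrow> 'g word \<Rightarrow> 'g word" where
  "restrict_word I w = (\<lambda>q. case w q of None \<Rightarrow> None | Some a \<Rightarrow> if fst a \<in> I then Some a else None)"

lemma supp_restrict_word: "supp J (restrict_word I w) = supp (J \<inter> I) w"
  by (auto simp: supp_def restrict_word_def split: option.splits)

lemma restrict_word_in: "w \<in> words ZZ \<Longrightarrow> restrict_word I w \<in> words ZZ"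
  unfolding words_ZZ_iff supp_restrict_word
  by (auto simp: restrict_word_def split: option.splits if_splits intro: finite_subset[OF supp_Int])

lemma letters_restrict_word:
  assumes "finite (supp (J \<inter> I) w)"
  shows "letters J (restrict_word I w) = letters (J \<inter> I) w"
  using assms
  by (auto simp: letters_def supp_restrict_word) (auto simp: supp_def restrict_word_def)

lemma proj_restrict_word:
  assumes "w \<in> words ZZ"
  shows "proj ZZ m (restrict_word I w) = restr I (proj ZZ m w)"
  using assms by (simp add: restr_proj) (simp add: proj_eq letters_restrict_word finite_supp)

lemma abs_squash: "\<bar>squash x\<bar> < 1"
  by (auto simp: squash_def field_simps abs_if)

lemma unsquash_squash: "unsquash (squash x) = x"
proof -
  have "\<bar>squash x\<bar> = \<bar>x\<bar> / (1 + \<bar>x\<bar>)" by (simp add: squash_def)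
  then have "1 - \<bar>squash x\<bar> = 1 / (1 + \<bar>x\<bar>)"
    using diff_divide_distrib[of "1 + \<bar>x\<bar>" "\<bar>x\<bar>" "1 + \<bar>x\<bar>"] by simp
  then show ?thesis unfolding unsquash_def by (simp add: squash_def)
qed

lemma squash_unsquash: "\<bar>y\<bar> < 1 \<Longrightarrow> squash (unsquash y) = y"
proof -
  assume y: "\<bar>y\<bar> < 1"
  then have "\<bar>unsquash y\<bar> = \<bar>y\<bar> / (1 - \<bar>y\<bar>)" by (simp add: unsquash_def)
  then have "1 + \<bar>unsquash y\<bar> = 1 / (1 - \<bar>y\<bar>)"
    using add_divide_distrib[of "1 - \<bar>y\<bar>" "\<bar>y\<bar>" "1 - \<bar>y\<bar>"] y by simp
  then show ?thesis using y unfolding squash_def by (simp add: unsquash_def)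
qed

lemma squash_strict_mono: "x < y \<Longrightarrow> squash x < squash y"
proof -
  assume xy: "x < y"
  consider "x \<ge> 0" | "x < 0" "y \<ge> 0" | "y < 0" by linarith
  then show ?thesis
  proof cases
    case 1
    then show ?thesis using xy by (simp add: squash_def divide_simps) (simp add: algebra_simps)
  next
    case 2
    then have "squash x < 0" "squash y \<ge> 0" by (simp_all add: squash_def divide_simps)
    then show ?thesis by linarith
  next
    case 3
    then show ?thesis using xy by (simp add: squash_def divide_simps) (simp add: algebra_simps)
  qed
qed

lemma concat_word_left: "concat_word u v (squash x - 1) = u x"
  using abs_squash[of x] by (auto simp: concat_word_def unsquash_squash)

lemma concat_word_right: "concat_word u v (squash x + 1) = v x"
  using abs_squash[of x] by (auto simp: concat_word_def unsquash_squash)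

lemma concat_word_cases:
  assumes "concat_word u v q = Some a"
  obtains x where "q = squash x - 1" "u x = Some a" | x where "q = squash x + 1" "v x = Some a"
proof (cases "-2 < q \<and> q < 0")
  case True
  then have "q = squash (unsquash (q + 1)) - 1" by (subst squash_unsquash) auto
  moreover have "u (unsquash (q + 1)) = Some a" using assms True by (simp add: concat_word_def)
  ultimately show thesis using that by blast
next
  case False
  then have q: "0 < q" "q < 2" "v (unsquash (q - 1)) = Some a"
    using assms by (auto simp: concat_word_def split: if_splits)
  then have "q = squash (unsquash (q - 1)) + 1" by (subst squash_unsquash) auto
  then show thesis using that q by blast
qed

lemma supp_concat_word:
  "supp I (concat_word u v) = (\<lambda>x. squash x - 1) ` supp I u \<union> (\<lambda>x. squash x + 1) ` supp I v"
proof
  show "supp I (concat_word u v) \<subseteq> (\<lambda>x. squash x - 1) ` supp I u \<union> (\<lambda>x. squash x + 1) ` supp I v"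
    by (auto simp: supp_def elim!: concat_word_cases)
qed (auto simp: supp_def concat_word_left concat_word_right)

lemma concat_word_in:
  assumes "u \<in> words ZZ" "v \<in> words ZZ" shows "concat_word u v \<in> words ZZ"
proof -
  have "g \<noteq> 0" if "concat_word u v q = Some (n, g)" for q n g
    using that assms unfolding words_ZZ_iff by (elim concat_word_cases) blast+
  then show ?thesis using assms unfolding words_ZZ_iff supp_concat_word by auto
qed

lemma letters_concat_word:
  assumes "finite (supp I u)" "finite (supp I v)"
  shows "letters I (concat_word u v) = letters I u @ letters I v"
proof -
  have "squash x - 1 < squash y + 1" for x y
    using abs_squash[of x] abs_squash[of y] by linarith
  moreover have "strict_mono_on A (\<lambda>x. squash x - 1)" "strict_mono_on A (\<lambda>x. squash x + 1)" for A
    by (auto simp: strict_mono_on_def squash_strict_mono)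
  ultimately have "sorted_list_of_set (supp I (concat_word u v)) =
      map (\<lambda>x. squash x - 1) (sorted_list_of_set (supp I u)) @
      map (\<lambda>x. squash x + 1) (sorted_list_of_set (supp I v))"
    unfolding supp_concat_word using assms
    by (subst sorted_list_of_set_Un) (auto simp: map_sorted_list_of_set)
  then show ?thesis
    by (simp add: letters_def comp_def concat_word_left concat_word_right)
qed

lemma proj_concat_word:
  assumes "u \<in> words ZZ" "v \<in> words ZZ"
  shows "proj ZZ m (concat_word u v) = proj ZZ m u \<otimes>\<^bsub>FZ\<^esub> proj ZZ m v"
  using assms
  by (simp add: proj_eq letters_concat_word finite_supp reduce_append_FZ nonzero_letters_letters)

lemma supp_inv_word: "supp I (inv_word G w) = uminus ` supp I w"
  by (force simp: supp_def inv_word_def image_iff)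

lemma inv_word_in: "w \<in> words ZZ \<Longrightarrow> inv_word ZZ w \<in> words ZZ"
  unfolding words_ZZ_iff supp_inv_word by (auto simp: inv_word_def)

lemma letters_inv_word:
  assumes "finite (supp I w)"
  shows "letters I (inv_word ZZ w) = inv_letters (letters I w)"
proof -
  have "sorted_list_of_set (uminus ` supp I w) = rev (map uminus (sorted_list_of_set (supp I w)))"
  proof (rule sorted_distinct_set_unique)
    have "sorted (rev (map uminus xs))" if "sorted xs" for xs :: "rat list"
      using that by (induction xs) (auto simp: sorted_append)
    then show "sorted (rev (map uminus (sorted_list_of_set (supp I w))))" by simp
  qed (use assms in \<open>auto simp: distinct_map\<close>)
  moreover have "the (inv_word ZZ w (- q)) = (fst (the (w q)), - snd (the (w q)))" if "q \<in> supp I w" for q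
    using that by (auto simp: inv_word_def supp_def)
  ultimately show ?thesis
    using assms by (simp add: letters_def inv_letters_def supp_inv_word rev_map)
qed

lemma proj_inv_word:
  assumes "w \<in> words ZZ"
  shows "proj ZZ m (inv_word ZZ w) \<otimes>\<^bsub>FZ\<^esub> proj ZZ m w = \<one>\<^bsub>FZ\<^esub>"
  using assms reduce_append_FZ[of "letters {..m} (inv_word ZZ w)" "letters {..m} w"]
  by (simp add: proj_eq letters_inv_word finite_supp nonzero_letters_letters reduce_inv_letters_append)
     (simp add: FZ_simps)

lemma proj_in [simp]: "w \<in> words ZZ \<Longrightarrow> proj ZZ m w \<in> carrier FZ"
  by (simp add: proj_eq FZ_simps reduced_reduce nonzero_letters_letters)

lemma empty_word_in: "(\<lambda>_. None) \<in> words ZZ"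
  by (simp add: words_ZZ_iff supp_def)

lemma proj_empty_word: "proj ZZ m (\<lambda>_. None) = \<one>\<^bsub>FZ\<^esub>"
  by (simp add: proj_eq letters_def supp_def FZ_simps)

section \<open>The topologist's product as a group\<close>

abbreviation HZ :: "int word set monoid" where "HZ \<equiv> top_product ZZ"

text \<open>The same choice of representative that \<open>class_mult\<close> makes.\<close>

definition rep :: "int word set \<Rightarrow> int word" where "rep C = (SOME w. w \<in> C)"

definition class_proj :: "nat \<Rightarrow> int word set \<Rightarrow> (nat \<times> int) list" where
  "class_proj m C = proj ZZ m (rep C)"

lemma carrier_HZ: "carrier HZ = wclass ZZ ` words ZZ"
  by (simp add: top_product_def)

lemma one_HZ: "\<one>\<^bsub>HZ\<^esub> = wclass ZZ (\<lambda>_. None)"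
  by (simp add: top_product_def)

lemma self_in_wclass: "w \<in> words ZZ \<Longrightarrow> w \<in> wclass ZZ w"
  by (simp add: wclass_def word_equiv_def)

lemma rep_wclass:
  assumes "w \<in> words ZZ"
  shows "rep (wclass ZZ w) \<in> words ZZ" "proj ZZ m (rep (wclass ZZ w)) = proj ZZ m w"
proof -
  have "rep (wclass ZZ w) \<in> wclass ZZ w"
    unfolding rep_def using someI[of "\<lambda>v. v \<in> wclass ZZ w" w] self_in_wclass[OF assms] by blast
  moreover have "v \<in> words ZZ \<and> proj ZZ m v = proj ZZ m w" if "v \<in> wclass ZZ w" for v
    using that by (simp add: wclass_def word_equiv_def)
  ultimately show "rep (wclass ZZ w) \<in> words ZZ" "proj ZZ m (rep (wclass ZZ w)) = proj ZZ m w"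
    by blast+
qed

lemma class_proj_wclass [simp]: "w \<in> words ZZ \<Longrightarrow> class_proj m (wclass ZZ w) = proj ZZ m w"
  by (simp add: class_proj_def rep_wclass)

lemma wclass_eqI:
  assumes "\<And>m. proj ZZ m u = proj ZZ m v" shows "wclass ZZ u = wclass ZZ v"
  using assms by (simp add: wclass_def word_equiv_def)

lemma mult_HZ:
  assumes "u \<in> words ZZ" "v \<in> words ZZ"
  shows "wclass ZZ u \<otimes>\<^bsub>HZ\<^esub> wclass ZZ v = wclass ZZ (concat_word u v)"
proof -
  have "wclass ZZ u \<otimes>\<^bsub>HZ\<^esub> wclass ZZ v = wclass ZZ (concat_word (rep (wclass ZZ u)) (rep (wclass ZZ v)))"
    by (simp add: top_product_def class_mult_def rep_def)
  also have "\<dots> = wclass ZZ (concat_word u v)"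
    using assms by (intro wclass_eqI) (simp add: proj_concat_word rep_wclass)
  finally show ?thesis .
qed

lemma wclass_in [simp]: "w \<in> words ZZ \<Longrightarrow> wclass ZZ w \<in> carrier HZ"
  by (simp add: carrier_HZ)

lemma wclassE:
  assumes "C \<in> carrier HZ" obtains w where "w \<in> words ZZ" "C = wclass ZZ w"
  using assms by (auto simp: carrier_HZ)

text \<open>The projections jointly embed \<open>HZ\<close> into a product of free groups, so the
  group laws are inherited from \<open>FZ\<close>.\<close>

lemma HZ_eqI:
  assumes "C \<in> carrier HZ" "D \<in> carrier HZ" "\<And>m. class_proj m C = class_proj m D"
  shows "C = D"
proof -
  obtain u v where uv: "u \<in> words ZZ" "C = wclass ZZ u" "v \<in> words ZZ" "D = wclass ZZ v"
    using wclassE[OF assms(1)] wclassE[OF assms(2)] by metis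
  have "proj ZZ m u = proj ZZ m v" for m using assms(3)[of m] uv by simp
  then show ?thesis unfolding uv by (rule wclass_eqI)
qed

lemma class_proj_mult:
  assumes "C \<in> carrier HZ" "D \<in> carrier HZ"
  shows "C \<otimes>\<^bsub>HZ\<^esub> D \<in> carrier HZ" "class_proj m (C \<otimes>\<^bsub>HZ\<^esub> D) = class_proj m C \<otimes>\<^bsub>FZ\<^esub> class_proj m D"
  using assms by (auto elim!: wclassE simp: mult_HZ concat_word_in proj_concat_word)

lemma class_proj_in [simp]: "C \<in> carrier HZ \<Longrightarrow> class_proj m C \<in> carrier FZ"
  by (auto elim!: wclassE)

lemma class_proj_one: "\<one>\<^bsub>HZ\<^esub> \<in> carrier HZ" "class_proj m \<one>\<^bsub>HZ\<^esub> = \<one>\<^bsub>FZ\<^esub>"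
  by (simp_all add: one_HZ empty_word_in proj_empty_word)

lemma group_HZ: "group HZ"
proof (rule groupI)
  fix A B C assume "A \<in> carrier HZ" "B \<in> carrier HZ" "C \<in> carrier HZ"
  then show "A \<otimes>\<^bsub>HZ\<^esub> B \<otimes>\<^bsub>HZ\<^esub> C = A \<otimes>\<^bsub>HZ\<^esub> (B \<otimes>\<^bsub>HZ\<^esub> C)"
    by (intro HZ_eqI) (simp_all add: class_proj_mult FZ.m_assoc)
next
  fix A assume "A \<in> carrier HZ"
  then obtain w where w: "w \<in> words ZZ" "A = wclass ZZ w" by (rule wclassE)
  then have "wclass ZZ (inv_word ZZ w) \<otimes>\<^bsub>HZ\<^esub> A = \<one>\<^bsub>HZ\<^esub>"
    by (intro HZ_eqI) (simp_all add: class_proj_mult class_proj_one inv_word_in proj_inv_word)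
  then show "\<exists>B\<in>carrier HZ. B \<otimes>\<^bsub>HZ\<^esub> A = \<one>\<^bsub>HZ\<^esub>"
    using w by (intro bexI[of _ "wclass ZZ (inv_word ZZ w)"]) (simp_all add: inv_word_in)
next
  fix A assume "A \<in> carrier HZ"
  then show "\<one>\<^bsub>HZ\<^esub> \<otimes>\<^bsub>HZ\<^esub> A = A"
    by (intro HZ_eqI) (simp_all add: class_proj_mult class_proj_one)
qed (simp_all add: class_proj_mult class_proj_one)

interpretation HZ: group HZ by (rule group_HZ)

lemma class_proj_hom: "class_proj m \<in> hom HZ FZ"
  by (rule homI) (simp_all add: class_proj_mult)

section \<open>Window projections and their kernels\<close>

definition proj_between :: "nat \<Rightarrow> nat \<Rightarrow> int word set \<Rightarrow> (nat \<times> int) list" where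
  "proj_between n m = restr {n..} \<circ> class_proj m"

lemma group_hom_proj_between: "group_hom HZ FZ (proj_between n m)"
  unfolding proj_between_def
  using hom_compose[OF class_proj_hom restr_hom]
  by (intro group_hom.intro group_hom_axioms.intro group_HZ group_FZ)

lemma proj_between_wclass:
  "w \<in> words ZZ \<Longrightarrow> proj_between n m (wclass ZZ w) = reduce ZZ (letters {n..m} w)"
  by (simp add: proj_between_def restr_proj) (rule arg_cong[of _ _ "\<lambda>I. reduce ZZ (letters I w)"], auto)

lemma restr_proj_between:
  assumes "w \<in> words ZZ"
  shows "restr I (proj_between n m (wclass ZZ w)) = reduce ZZ (letters ({n..m} \<inter> I) w)"
  using assms by (simp add: proj_between_wclass restr_filter nonzero_letters_letters filter_letters finite_supp)

definition tail_kernel :: "nat \<Rightarrow> int word set set" where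
  "tail_kernel n = (\<Inter>m. kernel HZ FZ (proj_between n m))"

definition archipelago_kernel :: "int word set set" where
  "archipelago_kernel = (\<Union>n. tail_kernel n)"

lemma restr_one: "restr I \<one>\<^bsub>FZ\<^esub> = \<one>\<^bsub>FZ\<^esub>"
  by (rule hom_one[OF restr_hom group_FZ group_FZ])

lemma kernel_proj_between_antimono:
  "kernel HZ FZ (proj_between n (Suc m)) \<subseteq> kernel HZ FZ (proj_between n m)"
proof
  fix C assume C: "C \<in> kernel HZ FZ (proj_between n (Suc m))"
  then have "C \<in> carrier HZ" by (simp add: kernel_def)
  then obtain w where w: "w \<in> words ZZ" "C = wclass ZZ w" by (rule wclassE)
  have "{n..Suc m} \<inter> {..m} = {n..m}" by auto
  then have "proj_between n m C = restr {..m} (proj_between n (Suc m) C)"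
    using w by (simp add: restr_proj_between proj_between_wclass[of w n m])
  then show "C \<in> kernel HZ FZ (proj_between n m)" using C by (auto simp: kernel_def restr_one)
qed

lemma kernel_proj_between_mono:
  "kernel HZ FZ (proj_between n m) \<subseteq> kernel HZ FZ (proj_between (Suc n) m)"
proof
  fix C assume C: "C \<in> kernel HZ FZ (proj_between n m)"
  then have "C \<in> carrier HZ" by (simp add: kernel_def)
  then obtain w where w: "w \<in> words ZZ" "C = wclass ZZ w" by (rule wclassE)
  have "{n..m} \<inter> {Suc n..} = {Suc n..m}" by auto
  then have "proj_between (Suc n) m C = restr {Suc n..} (proj_between n m C)"
    using w by (simp add: restr_proj_between proj_between_wclass[of w "Suc n" m])
  then show "C \<in> kernel HZ FZ (proj_between (Suc n) m)" using C by (auto simp: kernel_def restr_one)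
qed

lemma tail_kernel_mono: "tail_kernel n \<subseteq> tail_kernel (Suc n)"
  unfolding tail_kernel_def using kernel_proj_between_mono by blast

lemma (in group) normal_INT:
  fixes N :: "nat \<Rightarrow> 'a set"
  assumes "\<And>n. N n \<lhd> G" shows "(\<Inter>n. N n) \<lhd> G"
proof (rule normal_invI)
  show "subgroup (\<Inter>n. N n) G"
    using assms by (intro subgroups_Inter) (auto intro: normal_imp_subgroup)
qed (use normal.inv_op_closed2[OF assms] in auto)

lemma (in group) normal_UN_chain:
  fixes N :: "nat \<Rightarrow> 'a set"
  assumes N: "\<And>n. N n \<lhd> G" and mono: "\<And>n. N n \<subseteq> N (Suc n)"
  shows "(\<Union>n. N n) \<lhd> G"
proof (rule normal_invI)
  have mono': "m \<le> n \<Longrightarrow> N m \<subseteq> N n" for m n by (rule lift_Suc_mono_le[of N, OF mono])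
  have sub: "subgroup (N n) G" for n using N normal_imp_subgroup by blast
  show "subgroup (\<Union>n. N n) G"
  proof (rule subgroupI)
    show "(\<Union>n. N n) \<subseteq> carrier G" using subgroup.subset[OF sub] by blast
    show "(\<Union>n. N n) \<noteq> {}" using subgroup.one_closed[OF sub] by blast
    show "inv a \<in> (\<Union>n. N n)" if "a \<in> (\<Union>n. N n)" for a
      using that subgroup.m_inv_closed[OF sub] by blast
    show "a \<otimes> b \<in> (\<Union>n. N n)" if ab: "a \<in> (\<Union>n. N n)" "b \<in> (\<Union>n. N n)" for a b
    proof -
      obtain m n where "a \<in> N m" "b \<in> N n" using ab by blast
      then have "a \<in> N (max m n)" "b \<in> N (max m n)"
        using mono'[of m "max m n"] mono'[of n "max m n"] by auto
      then show ?thesis using subgroup.m_closed[OF sub] by blast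
    qed
  qed
qed (use normal.inv_op_closed2[OF N] in auto)

lemma normal_tail_kernel: "tail_kernel n \<lhd> HZ"
  unfolding tail_kernel_def
  by (intro HZ.normal_INT group_hom.normal_kernel group_hom_proj_between)

lemma normal_archipelago_kernel: "archipelago_kernel \<lhd> HZ"
  unfolding archipelago_kernel_def
  by (intro HZ.normal_UN_chain normal_tail_kernel tail_kernel_mono)

lemma nielsen_archipelago_kernel: "nielsen HZ archipelago_kernel"
  unfolding archipelago_kernel_def
proof (rule HZ.nielsen_UN)
  show "nielsen HZ (tail_kernel n)" for n
    unfolding tail_kernel_def
    by (intro HZ.nielsen_INT group_hom.normal_kernel group_hom_proj_between kernel_proj_between_antimono
        group_hom.nielsen_kernel nielsen_FZ)
qed (rule normal_tail_kernel tail_kernel_mono)+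

lemma wclass_in_tail_kernel:
  "w \<in> words ZZ \<Longrightarrow> wclass ZZ w \<in> tail_kernel n \<longleftrightarrow> (\<forall>m. proj ZZ m (restrict_word {n..} w) = [])"
  by (auto simp: tail_kernel_def kernel_def proj_between_def proj_restrict_word) (simp_all add: FZ_simps)

section \<open>The normal closure of the finite words\<close>

definition cut_word :: "(rat \<Rightarrow> bool) \<Rightarrow> 'g word \<Rightarrow> 'g word" where
  "cut_word P w = (\<lambda>q. if P q then w q else None)"

lemma supp_cut_word: "supp I (cut_word P w) = {q \<in> supp I w. P q}"
  by (auto simp: supp_def cut_word_def)

lemma cut_word_in: "w \<in> words ZZ \<Longrightarrow> cut_word P w \<in> words ZZ"
  unfolding words_ZZ_iff supp_cut_word by (auto simp: cut_word_def)

lemma wclass_cut_word: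
  assumes w: "w \<in> words ZZ" and P: "\<And>x y. P x \<Longrightarrow> \<not> P y \<Longrightarrow> x < y"
  shows "wclass ZZ w = wclass ZZ (cut_word P w) \<otimes>\<^bsub>HZ\<^esub> wclass ZZ (cut_word (\<lambda>q. \<not> P q) w)"
proof -
  have "letters {..m} w = letters {..m} (cut_word P w) @ letters {..m} (cut_word (\<lambda>q. \<not> P q) w)" for m
  proof -
    have "supp {..m} w = {q \<in> supp {..m} w. P q} \<union> {q \<in> supp {..m} w. \<not> P q}" by auto
    then have "sorted_list_of_set (supp {..m} w) =
        sorted_list_of_set {q \<in> supp {..m} w. P q} @ sorted_list_of_set {q \<in> supp {..m} w. \<not> P q}"
      using sorted_list_of_set_Un[of "{q \<in> supp {..m} w. P q}" "{q \<in> supp {..m} w. \<not> P q}"]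
        finite_supp[OF w] P by auto
    then show ?thesis
      using finite_supp[OF w, of "{..m}"] by (simp add: letters_def supp_cut_word) (simp add: cut_word_def)
  qed
  then have "class_proj m (wclass ZZ w) =
      class_proj m (wclass ZZ (cut_word P w) \<otimes>\<^bsub>HZ\<^esub> wclass ZZ (cut_word (\<lambda>q. \<not> P q) w))" for m
    using w
    by (simp add: class_proj_mult cut_word_in)
      (simp add: proj_eq reduce_append_FZ nonzero_letters_letters cut_word_in)
  then show ?thesis using w by (intro HZ_eqI) (simp_all add: cut_word_in)
qed

text \<open>Deleting a single letter changes the class by a conjugate of that letter.\<close>

lemma restrict_word_cong_mod:
  assumes N: "N \<lhd> HZ" and sub: "free_prod_sub ZZ \<subseteq> N" and w: "w \<in> words ZZ"
  shows "wclass ZZ w \<otimes>\<^bsub>HZ\<^esub> inv\<^bsub>HZ\<^esub> (wclass ZZ (restrict_word {n..} w)) \<in> N"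
  using w
\<comment> \<open>Only finitely many letters have index below \<open>n\<close>; they are deleted one
  at a time.\<close>
proof (induction "card (supp {..<n} w)" arbitrary: w)
  case 0
  then have "supp {..<n} w = {}" using finite_supp[of w "{..<n}"] by simp
  then have "restrict_word {n..} w = w"
    by (force simp: restrict_word_def supp_def fun_eq_iff split: option.splits)
  then show ?case using 0 N normal_imp_subgroup subgroup.one_closed by fastforce
next
  case (Suc c)
  interpret N: normal N HZ by (rule N)
  have fin: "finite (supp {..<n} w)" using Suc.prems finite_supp by blast
  obtain q where q: "q \<in> supp {..<n} w" using Suc(2) by (metis card.empty equals0I old.nat.distinct(2))
  \<comment> \<open>The word splits as u a v, where \<open>a\<close> is the single letter at
    \<open>q\<close>, and \<open>w'\<close> is u v.\<close>
  define w' where "w' = cut_word (\<lambda>x. x \<noteq> q) w"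
  define u where "u = cut_word (\<lambda>x. x < q) w"
  define a where "a = cut_word (\<lambda>x. x = q) w"
  define v where "v = cut_word (\<lambda>x. x > q) w"
  have in_words: "w' \<in> words ZZ" "u \<in> words ZZ" "a \<in> words ZZ" "v \<in> words ZZ"
    using Suc.prems by (simp_all add: w'_def u_def a_def v_def cut_word_in)
  have "restrict_word {n..} w' = restrict_word {n..} w"
    using q by (auto simp: w'_def cut_word_def restrict_word_def supp_def fun_eq_iff split: option.splits)
  moreover have "supp {..<n} w' = supp {..<n} w - {q}" by (auto simp: w'_def supp_cut_word)
  then have "card (supp {..<n} w') = c" using Suc(2) q fin by simp
  ultimately have IH: "wclass ZZ w' \<otimes>\<^bsub>HZ\<^esub> inv\<^bsub>HZ\<^esub> (wclass ZZ (restrict_word {n..} w)) \<in> N"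
    using Suc(1)[of w'] in_words by simp
  have cut: "cut_word P (cut_word R w) = cut_word (\<lambda>x. P x \<and> R x) w" for P R
    by (auto simp: cut_word_def)
  have neg: "(\<lambda>x. \<not> x < q \<and> x \<noteq> q) = (\<lambda>x. x > q)" "(\<lambda>x. x \<le> q \<and> \<not> x < q) = (\<lambda>x. x = q)"
    "(\<lambda>x. \<not> x \<le> q \<and> \<not> x < q) = (\<lambda>x. x > q)" "(\<lambda>x. x < q \<and> x \<noteq> q) = (\<lambda>x. x < q)"
    by (auto simp: fun_eq_iff)
  have w'_eq: "wclass ZZ w' = wclass ZZ u \<otimes>\<^bsub>HZ\<^esub> wclass ZZ v"
    using wclass_cut_word[OF in_words(1), of "\<lambda>x. x < q"] by (simp add: w'_def u_def v_def cut neg)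
  have w_eq: "wclass ZZ w = wclass ZZ u \<otimes>\<^bsub>HZ\<^esub> (wclass ZZ a \<otimes>\<^bsub>HZ\<^esub> wclass ZZ v)"
    using wclass_cut_word[OF Suc.prems, of "\<lambda>x. x < q"]
      wclass_cut_word[OF cut_word_in[OF Suc.prems, of "\<lambda>x. \<not> x < q"], of "\<lambda>x. x \<le> q"]
    by (simp add: u_def v_def a_def cut neg)
  have "dom a \<subseteq> {q}" by (auto simp: a_def cut_word_def split: if_splits)
  then have "finite (dom a)" by (rule finite_subset) simp
  then have "wclass ZZ a \<in> free_prod_sub ZZ"
    using in_words self_in_wclass by (auto simp: free_prod_sub_def)
  then have "wclass ZZ a \<in> N" using sub by blast
  then have conj: "wclass ZZ u \<otimes>\<^bsub>HZ\<^esub> wclass ZZ a \<otimes>\<^bsub>HZ\<^esub> inv\<^bsub>HZ\<^esub> (wclass ZZ u) \<in> N"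
    using N.inv_op_closed2 in_words by simp
  let ?r = "wclass ZZ (restrict_word {n..} w)"
  have r: "?r \<in> carrier HZ" using Suc.prems by (simp add: restrict_word_in)
  have "wclass ZZ w = (wclass ZZ u \<otimes>\<^bsub>HZ\<^esub> wclass ZZ a \<otimes>\<^bsub>HZ\<^esub> inv\<^bsub>HZ\<^esub> (wclass ZZ u)) \<otimes>\<^bsub>HZ\<^esub> wclass ZZ w'"
  proof -
    have c: "wclass ZZ u \<in> carrier HZ" "wclass ZZ a \<in> carrier HZ" "wclass ZZ v \<in> carrier HZ"
      using in_words by simp_all
    then have "inv\<^bsub>HZ\<^esub> (wclass ZZ u) \<otimes>\<^bsub>HZ\<^esub> (wclass ZZ u \<otimes>\<^bsub>HZ\<^esub> wclass ZZ v) = wclass ZZ v"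
      by (simp add: HZ.m_assoc[symmetric])
    then show ?thesis unfolding w_eq w'_eq using c by (simp add: HZ.m_assoc)
  qed
  then have "wclass ZZ w \<otimes>\<^bsub>HZ\<^esub> inv\<^bsub>HZ\<^esub> ?r =
      (wclass ZZ u \<otimes>\<^bsub>HZ\<^esub> wclass ZZ a \<otimes>\<^bsub>HZ\<^esub> inv\<^bsub>HZ\<^esub> (wclass ZZ u)) \<otimes>\<^bsub>HZ\<^esub> (wclass ZZ w' \<otimes>\<^bsub>HZ\<^esub> inv\<^bsub>HZ\<^esub> ?r)"
    using in_words r by (simp add: HZ.m_assoc)
  then show ?case using conj IH N.m_closed by simp
qed

lemma free_prod_sub_subset: "free_prod_sub ZZ \<subseteq> archipelago_kernel"
proof
  fix C assume C: "C \<in> free_prod_sub ZZ"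
  then obtain w where w: "w \<in> C" "finite (dom w)" "C \<in> carrier HZ" by (auto simp: free_prod_sub_def)
  obtain v where v: "v \<in> words ZZ" "C = wclass ZZ v" using w(3) by (rule wclassE)
  have ww: "w \<in> words ZZ" "\<And>m. proj ZZ m v = proj ZZ m w"
    using w(1) v by (simp_all add: wclass_def word_equiv_def)
  then have Cw: "C = wclass ZZ w" unfolding v by (intro wclass_eqI) simp
  \<comment> \<open>\<open>n\<close> exceeds every index that occurs; \<open>insert 0\<close> makes
    \<open>Max\<close> meaningful for the empty word.\<close>
  define n where "n = Suc (Max (insert 0 ((fst \<circ> the \<circ> w) ` dom w)))"
  have "k < n" if "w q = Some (k, g)" for q k g
  proof -
    have "k \<in> insert 0 ((fst \<circ> the \<circ> w) ` dom w)" using that by (force simp: image_iff)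
    then show ?thesis using w(2) unfolding n_def by (simp add: less_Suc_eq_le del: insert_iff image_comp)
  qed
  then have "restrict_word {n..} w = (\<lambda>_. None)"
    by (fastforce simp: restrict_word_def fun_eq_iff split: option.splits)
  then have "C \<in> tail_kernel n"
    unfolding Cw using ww(1) by (simp add: wclass_in_tail_kernel proj_empty_word) (simp add: FZ_simps)
  then show "C \<in> archipelago_kernel" by (auto simp: archipelago_kernel_def)
qed

text \<open>For a class in \<open>tail_kernel n\<close>, the tail of the word has trivial class, so
  \<open>restrict_word_cong_mod\<close> puts the class itself into every normal subgroup containing
  the finite words.\<close>

lemma normal_closure_eq: "normal_closure HZ (free_prod_sub ZZ) = archipelago_kernel"
proof
  show "normal_closure HZ (free_prod_sub ZZ) \<subseteq> archipelago_kernel"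
    using normal_archipelago_kernel free_prod_sub_subset by (auto simp: normal_closure_def)
  have "archipelago_kernel \<subseteq> N" if N: "N \<lhd> HZ" "free_prod_sub ZZ \<subseteq> N" for N
  proof
    fix C assume "C \<in> archipelago_kernel"
    then obtain n where n: "C \<in> tail_kernel n" by (auto simp: archipelago_kernel_def)
    then have "C \<in> carrier HZ" by (auto simp: tail_kernel_def kernel_def)
    then obtain w where w: "w \<in> words ZZ" "C = wclass ZZ w" by (rule wclassE)
    have "wclass ZZ (restrict_word {n..} w) = \<one>\<^bsub>HZ\<^esub>"
      using n w unfolding one_HZ by (intro wclass_eqI) (simp add: wclass_in_tail_kernel proj_empty_word FZ_simps)
    then show "C \<in> N" using restrict_word_cong_mod[OF N w(1), of n] w by simp
  qed
  then show "archipelago_kernel \<subseteq> normal_closure HZ (free_prod_sub ZZ)"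
    unfolding normal_closure_def by blast
qed

lemma archipelago_Z_eq: "archipelago_Z = HZ Mod archipelago_kernel"
  by (simp add: archipelago_Z_def archipelago_def normal_closure_eq)

section \<open>Nested infinite products\<close>

text \<open>Powers are formed on words, not on classes, because the infinite product is a pointwise
  limit of words.\<close>

primrec power_word :: "nat \<Rightarrow> 'g word \<Rightarrow> 'g word" where
  "power_word 0 v = (\<lambda>_. None)"
| "power_word (Suc k) v = concat_word v (power_word k v)"

lemma power_word_in: "v \<in> words ZZ \<Longrightarrow> power_word k v \<in> words ZZ"
  by (induction k) (simp_all add: empty_word_in concat_word_in)

lemma wclass_power_word:
  "v \<in> words ZZ \<Longrightarrow> wclass ZZ (power_word k v) = wclass ZZ v [^]\<^bsub>HZ\<^esub> k"
proof (induction k)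
  case (Suc k)
  then show ?case using HZ.nat_pow_Suc2[of "wclass ZZ v" k]
    by (simp add: mult_HZ[symmetric] power_word_in)
qed (simp add: one_HZ)

text \<open>The words \<open>approx_word x k d n\<close> truncate the infinite product
  \<open>y n = x n (y (n+1))\<^sup>k\<^sup>n\<close> at depth \<open>d\<close>.\<close>

primrec approx_word :: "(nat \<Rightarrow> 'g word) \<Rightarrow> (nat \<Rightarrow> nat) \<Rightarrow> nat \<Rightarrow> nat \<Rightarrow> 'g word" where
  "approx_word x k 0 = (\<lambda>n _. None)"
| "approx_word x k (Suc d) = (\<lambda>n. concat_word (x n) (power_word (k n) (approx_word x k d (Suc n))))"

definition word_lim :: "(nat \<Rightarrow> 'g word) \<Rightarrow> 'g word \<Rightarrow> bool" where
  "word_lim U u \<longleftrightarrow> (\<forall>q. \<forall>\<^sub>F d in sequentially. U d q = u q)"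

lemma word_lim_unique:
  assumes "word_lim U u" "word_lim U v" shows "u = v"
proof
  fix q
  have "\<forall>\<^sub>F d in sequentially. U d q = u q \<and> U d q = v q"
    using assms by (auto simp: word_lim_def intro: eventually_conj)
  then obtain d where "U d q = u q \<and> U d q = v q"
    using eventually_happens'[OF sequentially_bot] by blast
  then show "u q = v q" by metis
qed

text \<open>Each position of a concatenation depends on at most one position of one factor, so
  concatenation is continuous for pointwise convergence.\<close>

lemma word_lim_concat:
  assumes "word_lim U u" "word_lim V v"
  shows "word_lim (\<lambda>d. concat_word (U d) (V d)) (concat_word u v)"
  using assms unfolding word_lim_def concat_word_def by (auto intro: eventually_mono)

lemma word_lim_Suc: "word_lim U u \<Longrightarrow> word_lim (\<lambda>d. U (Suc d)) u"
  unfolding word_lim_def eventually_sequentially by (meson le_SucI)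

lemma word_lim_const: "word_lim (\<lambda>_. u) u"
  by (simp add: word_lim_def)

lemma word_lim_power: "word_lim V v \<Longrightarrow> word_lim (\<lambda>d. power_word k (V d)) (power_word k v)"
  by (induction k) (simp_all add: word_lim_const word_lim_concat)

lemma concat_word_map_le: "u \<subseteq>\<^sub>m u' \<Longrightarrow> v \<subseteq>\<^sub>m v' \<Longrightarrow> concat_word u v \<subseteq>\<^sub>m concat_word u' v'"
  by (auto simp: map_le_def concat_word_def dom_def)

lemma power_word_map_le: "v \<subseteq>\<^sub>m v' \<Longrightarrow> power_word k v \<subseteq>\<^sub>m power_word k v'"
  by (induction k) (simp_all add: concat_word_map_le)

text \<open>Going one level deeper fills positions that were empty and moves no letter, since
  \<open>concat_word\<close> places its factors independently of their length.\<close>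

lemma approx_word_map_le: "approx_word x k d n \<subseteq>\<^sub>m approx_word x k (Suc d) n"
proof (induction d arbitrary: n)
  case 0 then show ?case by (simp add: map_le_def)
next
  case (Suc d)
  have "concat_word (x n) (power_word (k n) (approx_word x k d (Suc n)))
      \<subseteq>\<^sub>m concat_word (x n) (power_word (k n) (approx_word x k (Suc d) (Suc n)))"
    by (intro concat_word_map_le power_word_map_le map_le_refl Suc)
  then show ?case by simp
qed

lemma approx_word_map_le': "d \<le> e \<Longrightarrow> approx_word x k d n \<subseteq>\<^sub>m approx_word x k e n"
  by (induction e rule: dec_induct) (auto intro: map_le_trans approx_word_map_le simp del: approx_word.simps)

lemma ex_word_lim_approx: "\<exists>y. word_lim (\<lambda>d. approx_word x k d n) y"
proof -
  have "\<exists>a. \<forall>\<^sub>F d in sequentially. approx_word x k d n q = a" for q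
  proof (cases "\<exists>d a. approx_word x k d n q = Some a")
    case True
    then obtain d a where a: "approx_word x k d n q = Some a" by blast
    have "approx_word x k e n q = Some a" if "e \<ge> d" for e
      using approx_word_map_le'[OF that, of x k n] a by (metis domI map_le_def)
    then show ?thesis unfolding eventually_sequentially by blast
  next
    case False
    then show ?thesis by (intro exI[of _ None] always_eventually) (metis not_None_eq)
  qed
  then obtain y where "\<And>q. \<forall>\<^sub>F d in sequentially. approx_word x k d n q = y q" by metis
  then show ?thesis by (auto simp: word_lim_def)
qed

lemma restrict_concat_word:
  "restrict_word I (concat_word u v) = concat_word (restrict_word I u) (restrict_word I v)"
  by (auto simp: restrict_word_def concat_word_def fun_eq_iff)

lemma restrict_power_word: "restrict_word I (power_word k v) = power_word k (restrict_word I v)"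
  by (induction k) (simp_all add: restrict_concat_word, simp add: restrict_word_def)

lemma restrict_empty_word: "restrict_word I (\<lambda>_. None) = (\<lambda>_. None)"
  by (simp add: restrict_word_def)

lemma concat_empty_word: "concat_word (\<lambda>_. None) (\<lambda>_. None) = (\<lambda>_. None)"
  by (auto simp: concat_word_def)

lemma power_empty_word: "power_word k (\<lambda>_. None) = (\<lambda>_. None)"
  by (induction k) (simp_all add: concat_empty_word)

text \<open>Letters of index below \<open>m\<close> are complete at any depth \<open>d\<close> with
  m <= n + d, so each index occurs finitely often in the limit. The recursion holds on the nose for
  words, both sides being limits of the same truncations.\<close>

lemma infinite_product_words:
  fixes x :: "nat \<Rightarrow> int word" and k :: "nat \<Rightarrow> nat"
  assumes x: "\<And>n. x n \<in> words ZZ" and low: "\<And>n. restrict_word {..<n} (x n) = (\<lambda>_. None)"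
  shows "\<exists>y. \<forall>n. y n \<in> words ZZ \<and> restrict_word {..<n} (y n) = (\<lambda>_. None) \<and>
    wclass ZZ (y n) = wclass ZZ (x n) \<otimes>\<^bsub>HZ\<^esub> (wclass ZZ (y (Suc n)) [^]\<^bsub>HZ\<^esub> k n)"
proof -
  let ?a = "approx_word x k"
  define y where "y = (\<lambda>n. SOME u. word_lim (\<lambda>d. ?a d n) u)"
  have y: "word_lim (\<lambda>d. ?a d n) (y n)" for n
    unfolding y_def by (rule someI_ex[OF ex_word_lim_approx])
  have a_in: "?a d n \<in> words ZZ" for d n
    by (induction d arbitrary: n) (simp_all add: empty_word_in concat_word_in power_word_in x)
  have low': "restrict_word {..<m} (x n) = (\<lambda>_. None)" if "m \<le> n" for m n
    using low[of n] that by (force simp: restrict_word_def fun_eq_iff split: option.splits if_splits)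
  have a_low: "restrict_word {..<m} (?a d n) = (\<lambda>_. None)" if "m \<le> n" for m d n
    using that
    by (induction d arbitrary: n)
       (simp_all add: restrict_empty_word restrict_concat_word restrict_power_word low' concat_empty_word power_empty_word)
  \<comment> \<open>The deeper truncation inserts copies of \<open>x (n + d)\<close>, whose letters
    have index at least \<open>n + d\<close>.\<close>
  have step: "restrict_word {..<m} (?a (Suc d) n) = restrict_word {..<m} (?a d n)" if "m \<le> n + d" for m d n
    using that
  proof (induction d arbitrary: n)
    case 0
    then show ?case using a_low[of m n 1] by (simp add: restrict_empty_word)
  next
    case (Suc d)
    have "restrict_word {..<m} (?a (Suc d) (Suc n)) = restrict_word {..<m} (?a d (Suc n))"
      using Suc by simp
    then show ?case
      unfolding approx_word.simps(2)[of x k "Suc d"] approx_word.simps(2)[of x k d]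
      by (simp only: restrict_concat_word restrict_power_word)
  qed
  have stable: "restrict_word {..<m} (?a e n) = restrict_word {..<m} (?a d n)"
    if "m \<le> n + d" "d \<le> e" for m n d e
    using that(2,1) by (induction e rule: dec_induct) (simp_all add: step del: approx_word.simps)
  have y_approx: "restrict_word {..<m} (y n) = restrict_word {..<m} (?a d n)" if "m \<le> n + d" for m n d
  proof
    fix q
    have "\<forall>\<^sub>F e in sequentially. ?a e n q = y n q \<and> d \<le> e"
      using y[of n] by (auto simp: word_lim_def intro: eventually_conj eventually_ge_at_top)
    then obtain e where e: "?a e n q = y n q" "d \<le> e"
      using eventually_happens'[OF sequentially_bot] by blast
    have "restrict_word {..<m} (y n) q = restrict_word {..<m} (?a e n) q"
      using e(1) by (simp add: restrict_word_def)
    then show "restrict_word {..<m} (y n) q = restrict_word {..<m} (?a d n) q"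
      using stable[OF that e(2)] by simp
  qed
  have y_in: "y n \<in> words ZZ" for n
    unfolding words_ZZ_iff
  proof (intro conjI allI impI)
    fix q m and g :: int assume "y n q = Some (m, g)"
    moreover obtain d where "?a d n q = y n q"
      using y[of n] eventually_happens'[OF sequentially_bot] unfolding word_lim_def by blast
    ultimately show "g \<noteq> 0" using a_in[of d n] unfolding words_ZZ_iff by metis
  next
    fix m
    have "supp {m} (y n) = supp {m} (restrict_word {..<Suc m} (y n))"
      unfolding supp_restrict_word by (rule arg_cong[of _ _ "\<lambda>I. supp I (y n)"]) auto
    also have "\<dots> = supp {m} (restrict_word {..<Suc m} (?a (Suc m) n))"
      by (subst y_approx[of _ _ "Suc m"]) simp_all
    finally show "finite (supp {m} (y n))"
      using finite_supp[OF restrict_word_in[OF a_in]] by (simp del: approx_word.simps)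
  qed
  have y_low: "restrict_word {..<n} (y n) = (\<lambda>_. None)" for n
    using y_approx[of n n 0] by (simp add: restrict_empty_word)
  have "y n = concat_word (x n) (power_word (k n) (y (Suc n)))" for n
  proof (rule word_lim_unique)
    show "word_lim (\<lambda>d. ?a (Suc d) n) (y n)"
      by (rule word_lim_Suc[OF y])
    show "word_lim (\<lambda>d. ?a (Suc d) n) (concat_word (x n) (power_word (k n) (y (Suc n))))"
      unfolding approx_word.simps by (intro word_lim_concat word_lim_const word_lim_power y)
  qed
  then have "wclass ZZ (y n) = wclass ZZ (x n) \<otimes>\<^bsub>HZ\<^esub> (wclass ZZ (y (Suc n)) [^]\<^bsub>HZ\<^esub> k n)" for n
    by (metis mult_HZ wclass_power_word power_word_in x y_in)
  with y_in y_low show ?thesis by blast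
qed

section \<open>The archipelago group\<close>

lemma freely_reduced_replicate: "freely_reduced (replicate n a)"
  by (auto simp: freely_reduced_def)

context group begin

lemma eval_gword_replicate:
  "x \<in> carrier G \<Longrightarrow> eval_gword G (replicate n (x, b)) = (if b then x else inv x) [^] n"
proof (induction n)
  case (Suc n)
  then show ?case using nat_pow_Suc2[of x n] nat_pow_Suc2[of "inv x" n] by simp
qed simp

text \<open>A nonzero power of \<open>x\<close> is a nonempty reduced word over \<open>{x}\<close>.
  If it lies in \<open>N\<close>, then \<open>{x}\<close> is not free modulo \<open>N\<close>, and
  the smaller generating set can only be empty.\<close>

lemma nielsen_torsion_free:
  assumes N: "N \<lhd> G" and nie: "nielsen G N" and x: "x \<in> carrier G"
    and pow: "x [^] (j::int) \<in> N" "j \<noteq> 0"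
  shows "x \<in> N"
proof -
  let ?ws = "replicate (nat \<bar>j\<bar>) (x, j > 0)"
  have "eval_gword G ?ws = x [^] j"
  proof (cases j rule: int_cases2)
    case (nonneg n)
    then have "j > 0" "nat \<bar>j\<bar> = n" using pow(2) by auto
    then show ?thesis using x eval_gword_replicate[of x n True] nonneg by (simp add: int_pow_int)
  next
    case (nonpos n)
    then have "\<not> j > 0" "nat \<bar>j\<bar> = n" by auto
    then show ?thesis using x eval_gword_replicate[of x n False] nonpos
      by (simp add: int_pow_neg int_pow_int nat_pow_inv)
  qed
  moreover have "?ws \<noteq> []" "fst ` set ?ws \<subseteq> {x}" using pow(2) by auto
  ultimately have "\<not> free_mod G N {x}"
    using pow(1) freely_reduced_replicate unfolding free_mod_def by metis
  then obtain T where "finite T" "card T < card {x}" "generate G (T \<union> N) = generate G ({x} \<union> N)"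
    using nielsenE[OF nie, of "{x}"] x by auto
  then have "x \<in> generate G N" using generate.incl[of x "{x} \<union> N" G] by auto
  then show ?thesis
    using generate_subgroup_incl[OF order_refl normal_imp_subgroup[OF N]] by blast
qed

text \<open>The finite set is lifted to \<open>V\<close> in \<open>G\<close>; a generating set of
  minimal size modulo \<open>N\<close> is free by \<open>minimal_free_mod\<close>, and its image is
  the basis.\<close>

lemma nielsen_locally_free:
  assumes N: "N \<lhd> G" and nie: "nielsen G N"
    and S: "finite S" "S \<subseteq> carrier (G Mod N)"
  shows "free_group ((G Mod N)\<lparr>carrier := generate (G Mod N) S\<rparr>)"
proof -
  interpret N: normal N G by (rule N)
  interpret Q: group "G Mod N" by (rule N.factorgroup_is_group)
  define \<pi> where "\<pi> = (\<lambda>x. N #> x)"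
  interpret \<pi>: group_hom G "G Mod N" \<pi>
    unfolding \<pi>_def using N.r_coset_hom_Mod by unfold_locales
  have \<pi>N: "\<pi> x = \<one>\<^bsub>G Mod N\<^esub> \<longleftrightarrow> x \<in> N" if "x \<in> carrier G" for x
    using that coset_join1[OF _ that N.subgroup_axioms] coset_join2[OF that N.subgroup_axioms] by (auto simp: \<pi>_def)
  obtain V where V: "V \<subseteq> carrier G" "finite V" "S = \<pi> ` V"
    using S finite_subset_image[of S \<pi> "carrier G"] by (auto simp: carrier_FactGroup \<pi>_def)
  obtain T where T: "finite T" "T \<subseteq> carrier G" "card T = rank_mod G N V"
    "generate G (T \<union> N) = generate G (V \<union> N)" using rank_mod_witness V by metis
  have free: "free_mod G N T" using minimal_free_mod[OF nie T] .
  have gen: "generate (G Mod N) (\<pi> ` A) = \<pi> ` generate G (A \<union> N)" if "A \<subseteq> carrier G" for A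
  proof -
    have "generate (G Mod N) (\<pi> ` A) = generate (G Mod N) (\<pi> ` (A \<union> N))"
    proof
      show "generate (G Mod N) (\<pi> ` A) \<subseteq> generate (G Mod N) (\<pi> ` (A \<union> N))"
        by (rule Q.mono_generate) auto
      have "\<pi> ` (A \<union> N) \<subseteq> generate (G Mod N) (\<pi> ` A)"
      proof
        fix z assume "z \<in> \<pi> ` (A \<union> N)"
        then consider "z \<in> \<pi> ` A" | "z = \<one>\<^bsub>G Mod N\<^esub>" using \<pi>N N.mem_carrier by blast
        then show "z \<in> generate (G Mod N) (\<pi> ` A)"
          by cases (blast intro: generate.incl generate.one)+
      qed
      then show "generate (G Mod N) (\<pi> ` (A \<union> N)) \<subseteq> generate (G Mod N) (\<pi> ` A)"
        using that by (intro Q.generate_subgroup_incl Q.generate_is_subgroup) auto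
    qed
    then show ?thesis using \<pi>.generate_img[of "A \<union> N"] that N.subset by simp
  qed
  let ?L = "generate (G Mod N) S"
  have sub: "subgroup ?L (G Mod N)" using Q.generate_is_subgroup S by blast
  have genT: "generate (G Mod N) (\<pi> ` T) = ?L" using gen T V by simp
  have TL: "\<pi> ` T \<subseteq> ?L" unfolding genT[symmetric] by (auto intro: generate.incl)
  \<comment> \<open>Injectivity lets reduced words in the images lift to reduced words in
    \<open>T\<close>.\<close>
  have inj: "inj_on \<pi> T"
  proof (rule inj_onI, rule ccontr)
    fix s t assume st: "s \<in> T" "t \<in> T" "\<pi> s = \<pi> t" "s \<noteq> t"
    let ?ws = "[(s, False), (t, True)]"
    have c: "s \<in> carrier G" "t \<in> carrier G" using st T by auto
    then have "\<pi> (eval_gword G ?ws) = \<one>\<^bsub>G Mod N\<^esub>" using st(3) Q.l_inv[of "\<pi> t"] by (simp del: one_FactGroup mult_FactGroup)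
    then have "eval_gword G ?ws \<in> N" using \<pi>N[of "eval_gword G ?ws"] c by auto
    moreover have "freely_reduced ?ws" using st(4) by (simp add: freely_reduced_Cons)
    ultimately show False using free[unfolded free_mod_def, rule_format, of ?ws] st by simp
  qed
  have "eval_gword ((G Mod N)\<lparr>carrier := ?L\<rparr>) ws \<noteq> \<one>\<^bsub>G Mod N\<^esub>"
    if ws: "ws \<noteq> []" "fst ` set ws \<subseteq> \<pi> ` T" "freely_reduced ws" for ws
  proof -
    define us where "us = map (apfst (inv_into T \<pi>)) ws"
    have us: "fst ` set us \<subseteq> T" "us \<noteq> []" using ws by (auto simp: us_def inv_into_into)
    have ws_us: "ws = map (apfst \<pi>) us"
      unfolding us_def using ws(2) by (auto simp: f_inv_into_f intro!: map_idI[symmetric])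
    have "freely_reduced us"
      using ws(3) freely_reduced_map[OF inj_on_subset[OF inj us(1)]] unfolding ws_us by simp
    then have "eval_gword G us \<notin> N" using free us unfolding free_mod_def by blast
    then have "\<pi> (eval_gword G us) \<noteq> \<one>\<^bsub>G Mod N\<^esub>" using \<pi>N us(1) T(2) by simp
    then have "eval_gword (G Mod N) ws \<noteq> \<one>\<^bsub>G Mod N\<^esub>"
      using \<pi>.hom_eval_gword[of us] us(1) T(2) unfolding ws_us by auto
    then show ?thesis using Q.eval_gword_subgroup[OF sub, of ws] ws(2) TL by auto
  qed
  moreover have "generate ((G Mod N)\<lparr>carrier := ?L\<rparr>) (\<pi> ` T) = ?L"
    using Q.generate_consistent[OF TL sub] genT by simp
  ultimately have "free_basis ((G Mod N)\<lparr>carrier := ?L\<rparr>) (\<pi> ` T)"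
    using TL unfolding free_basis_def by (simp add: image_image)
  then show ?thesis
    using Q.subgroup_imp_group[OF sub] unfolding free_group_def by blast
qed

text \<open>\<open>g n\<close> plays the role of 1/(n+1)!, and the exponent \<open>n + 2\<close> is
  the ratio of consecutive factorials. Every rational is an integral multiple of some
  1/(n+1)!.\<close>

lemma ex_rat_embedding:
  assumes g: "\<And>n. g n \<in> carrier G" "\<And>n. g n = g (Suc n) [^] (n + 2)"
    and inf: "\<And>n (j::int). j \<noteq> 0 \<Longrightarrow> g n [^] j \<noteq> \<one>"
  shows "\<exists>h. h \<in> hom rat_group G \<and> inj_on h (carrier rat_group)"
proof -
  have up: "\<exists>c::int. g n = g (n + i) [^] c \<and> of_int c * fact (Suc n) = (fact (Suc (n + i)) :: rat)" for n i
  proof (induction i)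
    case 0
    show ?case using g(1) by (intro exI[of _ 1]) (simp add: int_pow_1)
  next
    case (Suc i)
    then obtain c :: int where c: "g n = g (n + i) [^] c" "of_int c * fact (Suc n) = (fact (Suc (n + i)) :: rat)" by blast
    define k where "k = n + i + 2"
    have "g (n + i) = g (Suc (n + i)) [^] int k"
      by (simp only: int_pow_int g(2)[of "n + i"] k_def)
    then have "g n = g (n + Suc i) [^] (int k * c)"
      using c(1) int_pow_pow[OF g(1), of "Suc (n + i)"] by simp
    moreover have "of_int (int k * c) * fact (Suc n) = (fact (Suc (n + Suc i)) :: rat)"
    proof -
      have "of_int (int k * c) * fact (Suc n) = of_nat k * (fact (Suc (n + i)) :: rat)"
        unfolding c(2)[symmetric] by simp
      also have "\<dots> = fact (Suc (Suc (n + i)))" by (subst fact_Suc) (simp add: k_def)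
      finally show ?thesis by simp
    qed
    ultimately show ?case by blast
  qed
  \<comment> \<open>\<open>R r n z\<close> expresses r = z/(n+1)!.\<close>
  define R where "R = (\<lambda>r n z. r * fact (Suc n) = (of_int z :: rat))"
  have R_shift: "\<exists>c::int. R r (n + i) (c * z) \<and> g n [^] z = g (n + i) [^] (c * z)" if "R r n z" for r n z i
  proof -
    obtain c :: int where c: "g n = g (n + i) [^] c" "of_int c * fact (Suc n) = (fact (Suc (n + i)) :: rat)"
      using up by blast
    have "r * fact (Suc (n + i)) = of_int c * (r * fact (Suc n))" unfolding c(2)[symmetric] by (simp only: mult_ac)
    then have "R r (n + i) (c * z)" using that unfolding R_def by (simp only: of_int_mult)
    moreover have "g n [^] z = g (n + i) [^] (c * z)" using c(1) int_pow_pow[OF g(1)] by simp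
    ultimately show ?thesis by blast
  qed
  have R_unique: "g n [^] z = g m [^] y" if Rs: "R r n z" "R r m y" for r n m z y
  proof -
    obtain c where c: "R r (n + m) (c * z)" "g n [^] z = g (n + m) [^] (c * z)"
      using R_shift[OF Rs(1), of m] by blast
    obtain d where d: "R r (m + n) (d * y)" "g m [^] y = g (m + n) [^] (d * y)"
      using R_shift[OF Rs(2), of n] by blast
    have "(of_int (c * z) :: rat) = of_int (d * y)"
      using c(1) d(1) unfolding R_def by (simp only: add.commute)
    then have "c * z = d * y" by (simp only: of_int_eq_iff)
    then show ?thesis using c(2) d(2) by (simp add: add.commute)
  qed
  have R_ex: "\<exists>n z. R r n z" for r
  proof -
    obtain a b where ab: "r = Fract a b" "b > 0" by (cases r) auto
    \<comment> \<open>A denominator b divides (b+1)!, so stage b suffices.\<close>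
    have "nat b dvd fact (Suc (nat b))" using ab(2) by (intro dvd_fact) auto
    then obtain k where k: "fact (Suc (nat b)) = nat b * k" by (auto elim: dvdE)
    have "(fact (Suc (nat b)) :: rat) = of_nat (fact (Suc (nat b)))" by (simp only: of_nat_fact)
    also have "\<dots> = of_int b * of_nat k" unfolding k using ab(2) by simp
    finally have "r * fact (Suc (nat b)) = of_int (a * int k)"
      using ab by (simp add: Fract_of_int_quotient del: fact_Suc)
    then show ?thesis unfolding R_def by blast
  qed
  define h where "h = (\<lambda>r. g (SOME n. \<exists>z. R r n z) [^] (SOME z. R r (SOME n. \<exists>z. R r n z) z))"
  have h: "h r = g n [^] z" if "R r n z" for r n z
  proof -
    have "\<exists>z. R r (SOME n. \<exists>z. R r n z) z" using R_ex[of r] by (rule someI_ex)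
    then have "R r (SOME n. \<exists>z. R r n z) (SOME z. R r (SOME n. \<exists>z. R r n z) z)" by (rule someI_ex)
    from R_unique[OF this that] show ?thesis by (simp add: h_def)
  qed
  have common: "\<exists>n y z. R r n y \<and> R s n z" for r s
  proof -
    obtain n y m z where nm: "R r n y" "R s m z" using R_ex by metis
    then obtain c d where "R r (n + m) (c * y)" "R s (m + n) (d * z)" using R_shift by metis
    then show ?thesis by (metis add.commute)
  qed
  have "h \<in> hom rat_group G"
  proof (rule homI)
    fix r s
    obtain n y z where *: "R r n y" "R s n z" using common by blast
    then have "R (r + s) n (y + z)" by (simp add: R_def distrib_right del: fact_Suc)
    then show "h (r \<otimes>\<^bsub>rat_group\<^esub> s) = h r \<otimes> h s"
      using * h g(1) by (simp add: rat_group_def int_pow_mult)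
  next
    fix r
    obtain n z where "R r n z" using R_ex by blast
    then show "h r \<in> carrier G" using h g(1) by simp
  qed
  moreover have "inj_on h (carrier rat_group)"
  proof (rule inj_onI)
    fix r s assume "h r = h s"
    moreover obtain n y z where *: "R r n y" "R s n z" using common by blast
    ultimately have "g n [^] y = g n [^] z" using h by metis
    then have "g n [^] (y - z) = \<one>" using g(1) by (simp add: int_pow_diff)
    then have "y = z" using inf[of "y - z" n] by auto
    then have "r * fact (Suc n) = s * fact (Suc n)" using * by (simp add: R_def del: fact_Suc)
    then show "r = s" by (simp del: fact_Suc)
  qed
  ultimately show ?thesis by blast
qed

end

lemma restrict_word_restrict_word: "restrict_word I (restrict_word J w) = restrict_word (I \<inter> J) w"
  by (auto simp: restrict_word_def fun_eq_iff split: option.splits)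

lemma restrict_word_empty: "restrict_word {} w = (\<lambda>_. None)"
  by (auto simp: restrict_word_def split: option.splits)

text \<open>All tails of \<open>w\<close> have the same value 1 under \<open>f\<close>, because they
  agree with \<open>w\<close> modulo the kernel. The exponent 3 is chosen because the recursion a =
  1 + 3a has the fixed point -1/2; exponent 2 would have the integral fixed point -1 and give no
  contradiction.\<close>

lemma no_hom_onto_integers:
  assumes f: "f \<in> hom HZ integer_group" and ker: "\<And>C. C \<in> archipelago_kernel \<Longrightarrow> f C = 0"
    and C: "C \<in> carrier HZ"
  shows "f C \<noteq> 1"
proof
  assume fC: "f C = 1"
  interpret f: group_hom HZ integer_group f
    using f by (intro group_hom.intro group_hom_axioms.intro group_HZ group_integer_group)
  obtain w where w: "w \<in> words ZZ" "C = wclass ZZ w" using C by (rule wclassE)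
  let ?x = "\<lambda>n. restrict_word {n..} w"
  have xin: "?x n \<in> words ZZ" for n using w(1) by (rule restrict_word_in)
  have low: "restrict_word {..<n} (?x n) = (\<lambda>_. None)" for n
    by (simp add: restrict_word_restrict_word flip: restrict_word_empty[of w])
      (rule arg_cong[of _ _ "\<lambda>I. restrict_word I w"], auto)
  have fx: "f (wclass ZZ (?x n)) = 1" for n
  proof -
    have "f (wclass ZZ w \<otimes>\<^bsub>HZ\<^esub> inv\<^bsub>HZ\<^esub> (wclass ZZ (?x n))) = 0"
      using ker restrict_word_cong_mod[OF normal_archipelago_kernel free_prod_sub_subset w(1)] by blast
    then show ?thesis using w xin fC f.hom_mult[of "wclass ZZ w"] f.hom_inv[of "wclass ZZ (?x n)"] by simp
  qed
  obtain y where "\<forall>n. y n \<in> words ZZ \<and> restrict_word {..<n} (y n) = (\<lambda>_. None) \<and>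
      wclass ZZ (y n) = wclass ZZ (?x n) \<otimes>\<^bsub>HZ\<^esub> (wclass ZZ (y (Suc n)) [^]\<^bsub>HZ\<^esub> (3::nat))"
    using infinite_product_words[of ?x "\<lambda>_. 3", OF xin low] by blast
  then have y: "y n \<in> words ZZ"
    "wclass ZZ (y n) = wclass ZZ (?x n) \<otimes>\<^bsub>HZ\<^esub> (wclass ZZ (y (Suc n)) [^]\<^bsub>HZ\<^esub> (3::nat))" for n
    by blast+
  define a where "a = (\<lambda>n. f (wclass ZZ (y n)))"
  have a: "a n = 1 + 3 * a (Suc n)" for n
    unfolding a_def using y(2)[of n] fx xin y(1) f.hom_nat_pow[of "wclass ZZ (y (Suc n))" 3] f.hom_mult[of "wclass ZZ (?x n)"]
    by simp
  text \<open>Thus \<open>2 * a n + 1\<close> is an odd number divisible by every power of 3.\<close>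
  have "2 * a 0 + 1 = 3 ^ n * (2 * a n + 1)" for n
  proof (induction n)
    case (Suc n)
    have "2 * a n + 1 = 3 * (2 * a (Suc n) + 1)" using a[of n] by simp
    with Suc show ?case by simp
  qed simp
  then have dvd: "(3::int) ^ n dvd 2 * a 0 + 1" for n by (metis dvd_triv_left)
  have "2 * a 0 + 1 \<noteq> 0" by presburger
  then have le: "(3::int) ^ n \<le> \<bar>2 * a 0 + 1\<bar>" for n using dvd_imp_le_int[OF _ dvd[of n]] by simp
  have less: "int n < 3 ^ n" for n
    by (rule order.strict_trans2[OF of_nat_less_two_power power_mono]) simp_all
  show False using le[of "nat \<bar>2 * a 0 + 1\<bar>"] less[of "nat \<bar>2 * a 0 + 1\<bar>"] by simp
qed

text \<open>The exponents are those required by \<open>ex_rat_embedding\<close>, and the error in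
  each divisibility relation is the single letter \<open>x n\<close>. Since all exponents are
  positive, occurrences of one generator accumulate instead of cancelling, which keeps the chain out
  of the kernel.\<close>

lemma ex_divisible_chain:
  "\<exists>y. \<forall>n. y n \<in> carrier HZ \<and> y n \<notin> archipelago_kernel \<and>
     y n \<otimes>\<^bsub>HZ\<^esub> inv\<^bsub>HZ\<^esub> (y (Suc n) [^]\<^bsub>HZ\<^esub> (n + 2)) \<in> archipelago_kernel"
proof -
  let ?x = "\<lambda>n. (\<lambda>q. if q = 0 then Some (n, 1) else None) :: int word"
  have supp_x: "supp I (?x n) = (if n \<in> I then {0} else {})" for I n by (auto simp: supp_def)
  have xin: "?x n \<in> words ZZ" for n unfolding words_ZZ_iff supp_x by auto
  have low: "restrict_word {..<n} (?x n) = (\<lambda>_. None)" for n by (auto simp: restrict_word_def)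
  obtain y where "\<forall>n. y n \<in> words ZZ \<and> restrict_word {..<n} (y n) = (\<lambda>_. None) \<and>
      wclass ZZ (y n) = wclass ZZ (?x n) \<otimes>\<^bsub>HZ\<^esub> (wclass ZZ (y (Suc n)) [^]\<^bsub>HZ\<^esub> (n + 2))"
    using infinite_product_words[of ?x "\<lambda>n. n + 2", OF xin low] by blast
  then have y: "y n \<in> words ZZ" "restrict_word {..<n} (y n) = (\<lambda>_. None)"
    "wclass ZZ (y n) = wclass ZZ (?x n) \<otimes>\<^bsub>HZ\<^esub> (wclass ZZ (y (Suc n)) [^]\<^bsub>HZ\<^esub> (n + 2))" for n
    by blast+
  let ?Y = "\<lambda>n. wclass ZZ (y n)"
  have "dom (?x n) \<subseteq> {0}" for n by (auto split: if_splits)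
  then have fin: "finite (dom (?x n))" for n by (rule finite_subset) simp
  have "wclass ZZ (?x n) \<in> free_prod_sub ZZ" for n
    unfolding free_prod_sub_def
    by (intro CollectI conjI wclass_in xin bexI[of _ "?x n"] fin self_in_wclass)
  then have xker: "wclass ZZ (?x n) \<in> archipelago_kernel" for n using free_prod_sub_subset by blast
  have step: "?Y n \<otimes>\<^bsub>HZ\<^esub> inv\<^bsub>HZ\<^esub> (?Y (Suc n) [^]\<^bsub>HZ\<^esub> (n + 2)) \<in> archipelago_kernel" for n
  proof -
    have "?Y n \<otimes>\<^bsub>HZ\<^esub> inv\<^bsub>HZ\<^esub> (?Y (Suc n) [^]\<^bsub>HZ\<^esub> (n + 2)) = wclass ZZ (?x n)"
      unfolding y(3)[of n] using xin y(1) by (simp add: HZ.m_assoc del: nat_pow_Suc)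
    then show ?thesis using xker by simp
  qed
  text \<open>Seen through the letter \<open>m\<close> alone, \<open>y n\<close> with \<open>n \<le> m\<close> is a nontrivial power of the \<open>m\<close>-th generator.\<close>
  have pw: "\<exists>k>0. proj_between m m (?Y n) = gen m [^]\<^bsub>FZ\<^esub> (k::nat)" if "n \<le> m" for n m
    using that
  proof (induction rule: inc_induct)
    case base
    interpret h: group_hom HZ FZ "proj_between m m" by (rule group_hom_proj_between)
    have "supp {m..m} (y (Suc m)) = {}"
      using y(2)[of "Suc m"] by (force simp: supp_def restrict_word_def fun_eq_iff split: option.splits if_splits)
    then have "proj_between m m (?Y (Suc m)) = \<one>\<^bsub>FZ\<^esub>"
      using y(1) by (simp add: proj_between_wclass letters_def FZ_simps)
    moreover have "proj_between m m (wclass ZZ (?x m)) = gen m"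
      using xin[of m] by (simp add: proj_between_wclass letters_def supp_x gen_def)
    ultimately have "proj_between m m (?Y m) = gen m"
      unfolding y(3)[of m] using xin y(1) h.hom_nat_pow[of "?Y (Suc m)" "m + 2"] by simp
    then show ?case by (intro exI[of _ 1]) simp
  next
    case (step n)
    interpret h: group_hom HZ FZ "proj_between m m" by (rule group_hom_proj_between)
    obtain k :: nat where k: "k > 0" "proj_between m m (?Y (Suc n)) = gen m [^]\<^bsub>FZ\<^esub> k" using step by blast
    have px: "proj_between m m (wclass ZZ (?x n)) = \<one>\<^bsub>FZ\<^esub>"
      using xin[of n] step by (simp add: proj_between_wclass letters_def supp_x FZ_simps)
    define e where "e = n + 2"
    have "proj_between m m (?Y n) = gen m [^]\<^bsub>FZ\<^esub> (k * e)"
      unfolding y(3)[of n, folded e_def] using px xin y(1) h.hom_nat_pow[of "?Y (Suc n)" e] k(2)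
      by (simp add: FZ.nat_pow_pow)
    then show ?case using k(1) by (intro exI[of _ "k * e"]) (simp add: e_def)
  qed
  have "?Y n \<notin> archipelago_kernel" for n
  proof
    assume "?Y n \<in> archipelago_kernel"
    then obtain m where m: "?Y n \<in> tail_kernel m" by (auto simp: archipelago_kernel_def)
    \<comment> \<open>The index must be at least \<open>m\<close> to stay in the kernel and at least
      \<open>n\<close> for that letter to occur in \<open>y n\<close>.\<close>
    have "?Y n \<in> tail_kernel (max m n)"
      using m lift_Suc_mono_le[of tail_kernel, OF tail_kernel_mono, of m "max m n"] by auto
    then have "proj_between (max m n) (max m n) (?Y n) = \<one>\<^bsub>FZ\<^esub>" by (auto simp: tail_kernel_def kernel_def)
    moreover obtain k :: nat where "k > 0" "proj_between (max m n) (max m n) (?Y n) = gen (max m n) [^]\<^bsub>FZ\<^esub> k"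
      using pw[of n "max m n"] by auto
    ultimately show False
      using int_pow_gen[of "max m n" "int k"] by (simp add: int_pow_int FZ_simps)
  qed
  with step wclass_in[OF y(1)] show ?thesis by (intro exI[of _ ?Y]) blast
qed

theorem theoremB:
  shows "(\<exists>h. h \<in> hom rat_group archipelago_Z \<and> inj_on h (carrier rat_group))
       \<and> \<not> (\<exists>N. N \<lhd> archipelago_Z \<and> archipelago_Z Mod N \<cong> integer_group)
       \<and> (\<forall>S. S \<subseteq> carrier archipelago_Z \<and> finite S \<longrightarrow>
              free_group (archipelago_Z\<lparr>carrier := generate archipelago_Z S\<rparr>))"
proof (intro conjI allI impI)
  let ?K = archipelago_kernel
  interpret K: normal ?K HZ by (rule normal_archipelago_kernel)
  interpret A: group archipelago_Z unfolding archipelago_Z_eq by (rule K.factorgroup_is_group)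
  define \<pi> where "\<pi> = (\<lambda>C. ?K #>\<^bsub>HZ\<^esub> C)"
  interpret \<pi>: group_hom HZ archipelago_Z \<pi>
    using K.r_coset_hom_Mod A.is_group unfolding archipelago_Z_eq \<pi>_def
    by (intro group_hom.intro group_hom_axioms.intro group_HZ)
  have one: "\<one>\<^bsub>archipelago_Z\<^esub> = ?K" by (simp add: archipelago_Z_eq)
  have \<pi>K: "\<pi> C = \<one>\<^bsub>archipelago_Z\<^esub> \<longleftrightarrow> C \<in> ?K" if "C \<in> carrier HZ" for C
    unfolding one \<pi>_def
    using HZ.coset_join1[OF _ that K.subgroup_axioms] HZ.coset_join2[OF that K.subgroup_axioms] by blast
  show "\<exists>h. h \<in> hom rat_group archipelago_Z \<and> inj_on h (carrier rat_group)"
  proof -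
    obtain y where "\<forall>n. y n \<in> carrier HZ \<and> y n \<notin> ?K \<and>
        y n \<otimes>\<^bsub>HZ\<^esub> inv\<^bsub>HZ\<^esub> (y (Suc n) [^]\<^bsub>HZ\<^esub> (n + 2)) \<in> ?K"
      using ex_divisible_chain by blast
    then have y: "y n \<in> carrier HZ" "y n \<notin> ?K"
      "y n \<otimes>\<^bsub>HZ\<^esub> inv\<^bsub>HZ\<^esub> (y (Suc n) [^]\<^bsub>HZ\<^esub> (n + 2)) \<in> ?K" for n
      by blast+
    show ?thesis
    proof (rule A.ex_rat_embedding[of "\<lambda>n. \<pi> (y n)"])
      show "\<pi> (y n) \<in> carrier archipelago_Z" for n using y(1) by simp
      show "\<pi> (y n) = \<pi> (y (Suc n)) [^]\<^bsub>archipelago_Z\<^esub> (n + 2)" for n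
      proof -
        define k where "k = n + 2"
        have "\<pi> (y n \<otimes>\<^bsub>HZ\<^esub> inv\<^bsub>HZ\<^esub> (y (Suc n) [^]\<^bsub>HZ\<^esub> k)) = \<one>\<^bsub>archipelago_Z\<^esub>"
          using \<pi>K[of "y n \<otimes>\<^bsub>HZ\<^esub> inv\<^bsub>HZ\<^esub> (y (Suc n) [^]\<^bsub>HZ\<^esub> k)"] y(1) y(3)[of n, folded k_def] by simp
        then have "\<pi> (y n) \<otimes>\<^bsub>archipelago_Z\<^esub> inv\<^bsub>archipelago_Z\<^esub> (\<pi> (y (Suc n)) [^]\<^bsub>archipelago_Z\<^esub> k) = \<one>\<^bsub>archipelago_Z\<^esub>"
          using y(1) \<pi>.hom_nat_pow[of "y (Suc n)" k] by simp
        then show ?thesis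
          unfolding k_def[symmetric]
          using y(1) A.inv_equality[of "\<pi> (y n)" "inv\<^bsub>archipelago_Z\<^esub> (\<pi> (y (Suc n)) [^]\<^bsub>archipelago_Z\<^esub> k)"]
          by simp
      qed
      show "\<pi> (y n) [^]\<^bsub>archipelago_Z\<^esub> j \<noteq> \<one>\<^bsub>archipelago_Z\<^esub>" if "j \<noteq> 0" for n and j :: int
      proof
        assume "\<pi> (y n) [^]\<^bsub>archipelago_Z\<^esub> j = \<one>\<^bsub>archipelago_Z\<^esub>"
        then have "\<pi> (y n [^]\<^bsub>HZ\<^esub> j) = \<one>\<^bsub>archipelago_Z\<^esub>" using y(1) \<pi>.hom_int_pow by simp
        then have "y n [^]\<^bsub>HZ\<^esub> j \<in> ?K" using \<pi>K y(1) by simp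
        then show False
          using HZ.nielsen_torsion_free[OF normal_archipelago_kernel nielsen_archipelago_kernel y(1) _ that] y(2) by blast
      qed
    qed
  qed
  show "\<not> (\<exists>N. N \<lhd> archipelago_Z \<and> archipelago_Z Mod N \<cong> integer_group)"
  proof
    assume "\<exists>N. N \<lhd> archipelago_Z \<and> archipelago_Z Mod N \<cong> integer_group"
    then obtain N \<phi> where N: "N \<lhd> archipelago_Z" and \<phi>: "\<phi> \<in> iso (archipelago_Z Mod N) integer_group"
      unfolding is_iso_def by blast
    interpret N: normal N archipelago_Z by (rule N)
    \<comment> \<open>An infinite cyclic quotient yields a homomorphism on \<open>HZ\<close> that
      kills the kernel and attains 1, which \<open>no_hom_onto_integers\<close> excludes.\<close>
    define f where "f = \<phi> \<circ> ((\<lambda>a. N #>\<^bsub>archipelago_Z\<^esub> a) \<circ> \<pi>)"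
    have f: "f \<in> hom HZ integer_group"
      unfolding f_def
      by (rule hom_compose[OF hom_compose[OF \<pi>.homh N.r_coset_hom_Mod] iso_imp_homomorphism[OF \<phi>]])
    have "1 \<in> \<phi> ` carrier (archipelago_Z Mod N)" using \<phi> by (simp add: iso_iff)
    then obtain a where a: "a \<in> carrier archipelago_Z" "\<phi> (N #>\<^bsub>archipelago_Z\<^esub> a) = 1"
      by (auto simp: carrier_FactGroup)
    moreover obtain C where "C \<in> carrier HZ" "a = \<pi> C"
      using a(1) by (auto simp: archipelago_Z_eq carrier_FactGroup \<pi>_def)
    ultimately have C: "C \<in> carrier HZ" "f C = 1" by (simp_all add: f_def)
    have "f D = 0" if "D \<in> ?K" for D
    proof -
      have "D \<in> carrier HZ" using that K.subset by blast
      then have "\<pi> D = \<pi> \<one>\<^bsub>HZ\<^esub>" using \<pi>K that by simp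
      then have "f D = f \<one>\<^bsub>HZ\<^esub>" by (simp add: f_def)
      also have "\<dots> = 0" using hom_one[OF f group_HZ group_integer_group] by simp
      finally show ?thesis .
    qed
    then show False using no_hom_onto_integers[OF f _ C(1)] C(2) by blast
  qed
  show "free_group (archipelago_Z\<lparr>carrier := generate archipelago_Z S\<rparr>)"
    if "S \<subseteq> carrier archipelago_Z \<and> finite S" for S
    using HZ.nielsen_locally_free[OF normal_archipelago_kernel nielsen_archipelago_kernel] that
    by (simp add: archipelago_Z_eq)
qed

end
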